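(* Let $\chi\in\mathcal R^\infty(\mathbf C^d)$. Then the following is true: (i) For $F\in A(\mathbf C^d)$ the following conditions are equivalent: (1) $F\in\mathcal A_{0,\flat_1}(\mathbf C^d)$; (2) for every $r\in\mathbf R_+^d$, $|F(z)|\lesssim e^{r_1|z_1|+\cdots+r_d|z_d|}$, $z\in\mathbf C^d$; (3) there exists $F_0\in A(\mathbf C^d)$ such that $F=\Pi_A(F_0\cdot\chi)$. (ii) The map $F\mapsto\Pi_A(F\cdot\chi)$ from $A(\mathbf C^d)$ to $\mathcal A_{0,\flat_1}(\mathbf C^d)$ is a homeomorphism.
   Context: Notation: $\mathbf R_+=(0,\infty)$, $\mathbf N=\{0,1,2,\dots\}$. Inequalities between vectors in $\mathbf R_+^d$ are coordinatewise. $D_r(0)=\{z\in\mathbf C^d: |z_j|<r_j,\ j=1,\dots,d\}$. $A(\mathbf C^d)$ is the set of entire functions. $g\lesssim h$ means $g\le Ch$ for a constant $C>0$ independent of the variable ($z$ or $\alpha$). Every entire $F$ is written $F(z)=\sum_{\alpha\in\mathbf N^d}c(F,\alpha)e_\alpha(z)$ with $e_\alpha(z)=z^\alpha/\sqrt{\alpha!}$. $\mathcal A_{0,\flat_1}(\mathbf C^d)$ is the set of such $F$ for which $|c(F,\alpha)|\lesssim r^\alpha\alpha!^{-1/2}$ for every $r\in\mathbf R_+^d$, with the Fréchet (projective limit) topology given by the norms $\sup_\alpha|c(F,\alpha)|r^{-\alpha}\alpha!^{1/2}$, $r\in\mathbf R_+^d$. $A(\mathbf C^d)$ coincides with $\mathcal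 A_{\flat_1}'(\mathbf C^d)$, i.e. the set of $F$ with $|c(F,\alpha)|\lesssim r^\alpha\alpha!^{1/2}$ for every $r\in\mathbf R_+^d$, with the Fréchet topology given by the norms $\sup_\alpha|c(F,\alpha)|r^{-\alpha}\alpha!^{-1/2}$, $r\in\mathbf R_+^d$ (the topology of locally uniform convergence). For $t_1\le t_2$ in $\mathbf R_+^d$, $\mathcal R^\infty_{t_1,t_2}(\mathbf C^d)$ is the set of non-negative $\chi\in L^\infty(\mathbf C^d)$ with support in $\overline{D_{t_2}(0)}$, of the form $\chi(z)=\chi_0(|z_1|,\dots,|z_d|)$ for some function $\chi_0$, and such that $\chi\ge c$ on $D_{t_1}(0)$ for some constant $c>0$. $\mathcal R^\infty(\mathbf C^d)=\bigcup_{t_1\le t_2}\mathcal R^\infty_{t_1,t_2}(\mathbf C^d)$. For compactly supported $F\in L^\infty(\mathbf C^d)$, $(\Pi_AF)(z)=\pi^{-d}\int_{\mathbf C^d}F(w)e^{(z,w)-|w|^2}\,d\lambda(w)$, where $(z,w)=\sum_jz_j\overline{w_j}$ and $d\lambda$ is the Lebesgue measure. *)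

theory Defs
  imports "HOL-Analysis.Analysis"
begin

text \<open>Points of \<open>C^d\<close> have type \<open>complex ^ 'd\<close>, points of \<open>R^d\<close> type \<open>real ^ 'd\<close>
  (ordered coordinatewise), multi-indices type \<open>'d \<Rightarrow> nat\<close>, with \<open>d = CARD('d)\<close>.\<close>

text \<open>The strict order on \<open>real ^ 'd\<close> is not the coordinatewise one, so
  \<open>0 < r\<close> would not express positivity of all coordinates.\<close>

definition pos_vecs :: "(real ^ 'd) set"
  where "pos_vecs = {r. \<forall>j. 0 < r $ j}"

definition mpow :: "'a::comm_monoid_mult ^ 'd::finite \<Rightarrow> ('d \<Rightarrow> nat) \<Rightarrow> 'a"
  where "mpow z \<alpha> = (\<Prod>j\<in>UNIV. (z $ j) ^ \<alpha> j)"

definition mfact :: "('d::finite \<Rightarrow> nat) \<Rightarrow> real"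
  where "mfact \<alpha> = (\<Prod>j\<in>UNIV. fact (\<alpha> j))"

definition polydisc :: "real ^ 'd \<Rightarrow> (complex ^ 'd) set"
  where "polydisc r = {z. \<forall>j. cmod (z $ j) < r $ j}"


text \<open>Entire functions: (Frechet) differentiable everywhere with complex-linear derivative.\<close>

definition entire :: "(complex ^ 'd::finite \<Rightarrow> complex) set"
  where "entire = {F. \<forall>z. \<exists>F'. (F has_derivative F') (at z) \<and>
                                (\<forall>a v. F' (a *s v) = a * F' v)}"

definition e_basis :: "('d::finite \<Rightarrow> nat) \<Rightarrow> complex ^ 'd \<Rightarrow> complex"
  where "e_basis \<alpha> z = mpow z \<alpha> / of_real (sqrt (mfact \<alpha>))"

text \<open>The coefficients \<open>c(F,\<alpha>)\<close> of the expansion of an entire \<open>F\<close> in the \<open>e_basis \<alpha>\<close>.\<close>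

definition coef :: "(complex ^ 'd::finite \<Rightarrow> complex) \<Rightarrow> ('d \<Rightarrow> nat) \<Rightarrow> complex"
  where "coef F = (THE c. \<forall>z. ((\<lambda>\<alpha>. c \<alpha> * e_basis \<alpha> z) has_sum F z) UNIV)"

definition A0_flat1 :: "(complex ^ 'd::finite \<Rightarrow> complex) set"
  where "A0_flat1 = {F \<in> entire. \<forall>r\<in>pos_vecs. \<exists>C>0. \<forall>\<alpha>.
           cmod (coef F \<alpha>) \<le> C * (mpow r \<alpha> / sqrt (mfact \<alpha>))}"


text \<open>The topology on a space \<open>S\<close> of functions defined by a family \<open>p i\<close>, \<open>i \<in> I\<close>, of seminorms:
  finite intersections of balls of the \<open>p i\<close> around \<open>F\<close> form a neighbourhood base at \<open>F\<close>.\<close>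

definition seminorm_topology ::
  "('a \<Rightarrow> complex) set \<Rightarrow> 'i set \<Rightarrow> ('i \<Rightarrow> ('a \<Rightarrow> complex) \<Rightarrow> real) \<Rightarrow> ('a \<Rightarrow> complex) topology"
  where "seminorm_topology S I p = topology (\<lambda>U. U \<subseteq> S \<and>
           (\<forall>F\<in>U. \<exists>J \<epsilon>. finite J \<and> J \<subseteq> I \<and> \<epsilon> > 0 \<and>
              {G \<in> S. \<forall>i\<in>J. p i (\<lambda>z. G z - F z) < \<epsilon>} \<subseteq> U))"

lemma openin_seminorm_topology:
  "openin (seminorm_topology S I p) U \<longleftrightarrow> U \<subseteq> S \<and>
     (\<forall>F\<in>U. \<exists>J \<epsilon>. finite J \<and> J \<subseteq> I \<and> \<epsilon> > 0 \<and>
        {G \<in> S. \<forall>i\<in>J. p i (\<lambda>z. G z - F z) < \<epsilon>} \<subseteq> U)"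
proof -
  define B where "B F J \<epsilon> = {G \<in> S. \<forall>i\<in>J. p i (\<lambda>z. G z - F z) < \<epsilon>}" for F J and \<epsilon> :: real
  define N where "N U F \<longleftrightarrow> (\<exists>J \<epsilon>. finite J \<and> J \<subseteq> I \<and> \<epsilon> > 0 \<and> B F J \<epsilon> \<subseteq> U)" for U F
  have N_Int: "N (U \<inter> V) F" if "N U F" "N V F" for U V F
  proof -
    obtain J \<epsilon> where J: "finite J" "J \<subseteq> I" "\<epsilon> > 0" "B F J \<epsilon> \<subseteq> U"
      using \<open>N U F\<close> unfolding N_def by metis
    obtain K \<delta> where K: "finite K" "K \<subseteq> I" "\<delta> > 0" "B F K \<delta> \<subseteq> V"
      using \<open>N V F\<close> unfolding N_def by metis
    have "B F (J \<union> K) (min \<epsilon> \<delta>) \<subseteq> B F J \<epsilon> \<inter> B F K \<delta>"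
      unfolding B_def by auto
    then have "B F (J \<union> K) (min \<epsilon> \<delta>) \<subseteq> U \<inter> V" using J(4) K(4) by blast
    moreover have "finite (J \<union> K)" "J \<union> K \<subseteq> I" "min \<epsilon> \<delta> > 0" using J K by simp_all
    ultimately show ?thesis unfolding N_def by metis
  qed
  have N_mono: "N V F" if "N U F" "U \<subseteq> V" for U V F
    using that unfolding N_def by (meson order_trans)
  have "istopology (\<lambda>U. U \<subseteq> S \<and> (\<forall>F\<in>U. N U F))"
    unfolding istopology_def
  proof (intro conjI allI impI)
    fix U V assume U: "U \<subseteq> S \<and> (\<forall>F\<in>U. N U F)" and V: "V \<subseteq> S \<and> (\<forall>F\<in>V. N V F)"
    show "U \<inter> V \<subseteq> S" using U by blast
    show "\<forall>F\<in>U \<inter> V. N (U \<inter> V) F" using U V N_Int by simp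
  next
    fix K assume K: "\<forall>U\<in>K. U \<subseteq> S \<and> (\<forall>F\<in>U. N U F)"
    show "\<Union>K \<subseteq> S" using K by blast
    show "\<forall>F\<in>\<Union>K. N (\<Union>K) F" using K by (meson N_mono UnionE Union_upper)
  qed
  from topology_inverse'[OF this]
  have "openin (topology (\<lambda>U. U \<subseteq> S \<and> (\<forall>F\<in>U. N U F))) U \<longleftrightarrow> U \<subseteq> S \<and> (\<forall>F\<in>U. N U F)"
    by (rule fun_cong)
  then show ?thesis
    unfolding seminorm_topology_def N_def B_def .
qed

lemma topspace_seminorm_topology [simp]: "topspace (seminorm_topology S I p) = S"
proof (rule subset_antisym)
  show "topspace (seminorm_topology S I p) \<subseteq> S"
    using openin_topspace[of "seminorm_topology S I p"]
    unfolding openin_seminorm_topology by (rule conjunct1)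
  have triv: "finite {} \<and> {} \<subseteq> I \<and> (1::real) > 0 \<and> {G \<in> S. \<forall>i\<in>{}. p i (\<lambda>z. G z - F z) < 1} \<subseteq> S" for F
    by auto
  have "openin (seminorm_topology S I p) S"
    unfolding openin_seminorm_topology
    by (intro conjI[OF order_refl] ballI exI) (rule triv)
  then show "S \<subseteq> topspace (seminorm_topology S I p)" by (rule openin_subset)
qed

text \<open>The suprema below are taken over bounded sets when \<open>F\<close> is in \<open>A0_flat1\<close>, respectively \<open>entire\<close>.\<close>

definition A0_flat1_norm :: "real ^ 'd \<Rightarrow> (complex ^ 'd::finite \<Rightarrow> complex) \<Rightarrow> real"
  where "A0_flat1_norm r F = (SUP \<alpha>. cmod (coef F \<alpha>) / mpow r \<alpha> * sqrt (mfact \<alpha>))"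

definition entire_norm :: "real ^ 'd \<Rightarrow> (complex ^ 'd::finite \<Rightarrow> complex) \<Rightarrow> real"
  where "entire_norm r F = (SUP \<alpha>. cmod (coef F \<alpha>) / mpow r \<alpha> / sqrt (mfact \<alpha>))"

definition A0_flat1_topology :: "(complex ^ 'd::finite \<Rightarrow> complex) topology"
  where "A0_flat1_topology = seminorm_topology A0_flat1 pos_vecs A0_flat1_norm"

definition entire_topology :: "(complex ^ 'd::finite \<Rightarrow> complex) topology"
  where "entire_topology = seminorm_topology entire pos_vecs entire_norm"


text \<open>Elements of \<open>L^\<infinity>\<close> are represented by functions, so the conditions on them
  are required almost everywhere.  In particular the (essential) support lies in a closed set
  iff the function vanishes almost everywhere off that set.\<close>

definition R_infty_on :: "real ^ 'd \<Rightarrow> real ^ 'd \<Rightarrow> (complex ^ 'd::finite \<Rightarrow> real) set"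
  where "R_infty_on t1 t2 = {h. h \<in> borel_measurable lebesgue \<and>
           (\<exists>B. AE z in lebesgue. \<bar>h z\<bar> \<le> B) \<and>
           (AE z in lebesgue. 0 \<le> h z) \<and>
           (AE z in lebesgue. z \<notin> closure (polydisc t2) \<longrightarrow> h z = 0) \<and>
           (\<exists>h0 :: real ^ 'd \<Rightarrow> real. AE z in lebesgue. h z = h0 (\<chi> j. cmod (z $ j))) \<and>
           (\<exists>c>0. AE z in lebesgue. z \<in> polydisc t1 \<longrightarrow> c \<le> h z)}"

definition R_infty :: "(complex ^ 'd::finite \<Rightarrow> real) set"
  where "R_infty = (\<Union>t1\<in>pos_vecs. \<Union>t2\<in>{t2 \<in> pos_vecs. t1 \<le> t2}. R_infty_on t1 t2)"

definition herm :: "complex ^ 'd::finite \<Rightarrow> complex ^ 'd \<Rightarrow> complex"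
  where "herm z w = (\<Sum>j\<in>UNIV. z $ j * cnj (w $ j))"

definition Pi_A :: "(complex ^ 'd::finite \<Rightarrow> complex) \<Rightarrow> complex ^ 'd \<Rightarrow> complex"
  where "Pi_A F z = of_real (1 / pi ^ CARD('d)) *
           (\<integral>w. F w * exp (herm z w - of_real ((norm w)\<^sup>2)) \<partial>lebesgue)"

end

theory Submission
  imports Defs "HOL-Complex_Analysis.Cauchy_Integral_Formula" "HOL-Probability.Infinite_Product_Measure"
begin

text \<open>
  Put \<open>g w = \<pi>\<^sup>-\<^sup>d h w exp (- |w|\<^sup>2)\<close>.  Since \<open>g\<close> is invariant under rotation of each coordinate, the
  monomials are orthogonal for the measure with density \<open>g\<close>.  Expanding \<open>F\<close> and the kernel
  \<open>exp (z, w)\<close> shows that the operator acts diagonally on Taylor coefficients: it multiplies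
  the coefficient of index \<open>\<beta>\<close> by \<open>m \<beta> / \<beta>!\<close>, where \<open>m \<beta>\<close> is the integral of \<open>g w |w\<^sup>\<beta>|\<^sup>2\<close>.
  The support of \<open>h\<close> and its lower bound near the origin squeeze \<open>m \<beta>\<close> between constant
  multiples of \<open>s\<^sup>2\<^sup>\<beta>\<close> and \<open>R\<^sup>2\<^sup>\<beta>\<close>.  As all \<open>r\<close> are allowed in the definitions of both spaces, geometric
  factors are harmless, so the multiplication is bijective and bounded in both directions.
\<close>

text \<open>The obstacle is that \<open>coef\<close> is a definite description, applied to functions
  that are only known to be complex differentiable. It yields nothing until each of them is shown to
  have a global expansion, and only one. Existence comes from Cauchy's formula iterated over the
  coordinates, with the kernel expanded geometrically. Uniqueness reuses the orthogonality of
  monomials, with the indicator of a polydisc as weight; this is why weights are treated abstractly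
  before any entire function appears. Surjectivity in turn needs functions with prescribed
  coefficients, so convergent power series must be shown to be differentiable.

  For plain Taylor coefficients, being entire means a bound by a multiple of r^\<alpha> for every r,
  and \<open>A0_flat1\<close> asks for a multiple of r^\<alpha>/\<alpha>!. Dividing by \<beta>! is
  therefore exactly the passage between the two spaces, and both continuity claims become explicit
  estimates between single norms.\<close>

no_notation fps_nth (infixl "$" 75)


section \<open>Isometries preserve Lebesgue measure\<close>

lemma emeasure_lborel_ball_shift:
  fixes a b :: "'a::euclidean_space"
  shows "emeasure lborel (ball a r) = emeasure lborel (ball b r)"
  using emeasure_ball[of r a] emeasure_ball[of r b] by (cases "r \<ge> 0") (auto simp: ball_empty)

text \<open>By Vitali's theorem an open set is, up to a null set, a countable disjoint union of
  balls contained in it. A linear isometry maps each ball onto a ball of the same radius, hence of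
  the same measure, and it maps the null remainder to a null set because it is
  differentiable.\<close>

lemma emeasure_isometry_le:
  fixes g :: "'a::euclidean_space \<Rightarrow> 'a"
  assumes lin: "linear g" and iso: "\<And>x. norm (g x) = norm x" and U: "open U"
  shows "emeasure lebesgue (g ` U) \<le> emeasure lebesgue U"
proof -
  have dist: "dist (g x) (g y) = dist x y" for x y
    using iso[of "x - y"] by (simp add: dist_norm linear_diff[OF lin])
  have inj: "inj g" by (metis dist injI dist_eq_0_iff)
  have surj: "surj g" using lin inj linear_injective_imp_surjective by blast
  have imball: "g ` ball a r = ball (g a) r" for a r
  proof safe
    fix y assume "y \<in> ball (g a) r"
    moreover obtain x where "y = g x" using surj by (metis surjD)
    ultimately show "y \<in> g ` ball a r" by (simp add: dist)
  qed (simp add: dist)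
  define K where "K = {(a, r). 0 < r \<and> ball a r \<subseteq> U}"
  have "\<exists>i. i \<in> K \<and> x \<in> ball (fst i) (snd i) \<and> snd i < d" if "x \<in> U" "0 < d" for x d
  proof -
    obtain e where e: "e > 0" "ball x e \<subseteq> U" using U \<open>x \<in> U\<close> by (meson open_contains_ball)
    define s where "s = min e (d/2)"
    have s: "0 < s" "s < d" "s \<le> e" using e \<open>0 < d\<close> by (auto simp: s_def)
    then have "ball x s \<subseteq> U" using e(2) subset_ball[of s e x] by (rule_tac subset_trans)
    then have "(x, s) \<in> K" using s by (simp add: K_def)
    then show ?thesis using s by (intro exI[of _ "(x, s)"]) simp
  qed
  then obtain C where C: "countable C" "C \<subseteq> K"
     "pairwise (\<lambda>i j. disjnt (ball (fst i) (snd i)) (ball (fst j) (snd j))) C"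
     "negligible (U - (\<Union>i \<in> C. ball (fst i) (snd i)))"
    by (rule Vitali_covering_theorem_balls[of U K fst snd]) auto
  let ?B = "\<lambda>i. ball (fst i) (snd i)"
  let ?N = "U - (\<Union>i \<in> C. ?B i)"
  have subU: "(\<Union>i\<in>C. ?B i) \<subseteq> U" using C(2) unfolding K_def by fastforce
  have disj: "disjoint_family_on ?B C"
    using C(3) by (auto simp: disjoint_family_on_def pairwise_def disjnt_def)
  have "negligible (g ` ?N)"
    by (rule negligible_differentiable_image_negligible[OF order_refl C(4)])
      (simp add: lin linear_imp_differentiable_on)
  then have null: "g ` ?N \<in> null_sets lebesgue" by (simp add: negligible_iff_null_sets)
  have "g ` U = g ` ?N \<union> (\<Union>i\<in>C. ball (g (fst i)) (snd i))"
    unfolding imball[symmetric] using subU by blast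
  then have "emeasure lebesgue (g ` U)
      = emeasure lebesgue (g ` ?N \<union> (\<Union>i\<in>C. ball (g (fst i)) (snd i)))" by simp
  also have "\<dots> = emeasure lebesgue (\<Union>i\<in>C. ball (g (fst i)) (snd i))"
    using null by (subst Un_commute, intro emeasure_Un_null_set sets.countable_UN') (auto simp: C(1))
  also have "\<dots> = (\<integral>\<^sup>+i. emeasure lebesgue (ball (g (fst i)) (snd i)) \<partial>count_space C)"
  proof (rule emeasure_UN_countable)
    have "ball (g (fst i)) (snd i) \<inter> ball (g (fst j)) (snd j) = g ` (?B i \<inter> ?B j)" for i j
      unfolding imball[symmetric] by (rule image_Int[OF inj, symmetric])
    then show "disjoint_family_on (\<lambda>i. ball (g (fst i)) (snd i)) C"
      using disj by (simp add: disjoint_family_on_def)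
  qed (use C(1) in auto)
  also have "\<dots> = (\<integral>\<^sup>+i. emeasure lebesgue (?B i) \<partial>count_space C)"
    by (intro nn_integral_cong) (simp add: emeasure_lborel_ball_shift)
  also have "\<dots> = emeasure lebesgue (\<Union>i\<in>C. ?B i)"
    using C(1) disj by (intro emeasure_UN_countable[symmetric]) auto
  also have "\<dots> \<le> emeasure lebesgue U"
    using subU U by (intro emeasure_mono) auto
  finally show ?thesis .
qed

text \<open>The inequality for open sets, applied to \<open>f\<close> and to its inverse, gives
  equality on boxes, and boxes determine Lebesgue measure.\<close>

lemma lborel_distr_isometry:
  fixes f :: "'a::euclidean_space \<Rightarrow> 'a"
  assumes lin: "linear f" and iso: "\<And>x. norm (f x) = norm x"
  shows "distr lborel borel f = lborel"
proof (rule lborel_eqI[symmetric])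
  have [measurable]: "f \<in> borel_measurable borel"
    using lin by (simp add: borel_measurable_continuous_onI linear_continuous_on linear_linear)
  have inj: "inj f" using lin iso by (metis linear_injective_0 norm_eq_zero)
  obtain g where g: "linear g" "f \<circ> g = id" "g \<circ> f = id"
    using linear_injective_isomorphism[OF lin inj] by (metis comp_id fun.map_comp id_comp comp_def eq_id_iff)
  have fg: "f (g x) = x" "g (f x) = x" for x using g by (metis comp_apply id_apply)+
  have isog: "norm (g x) = norm x" for x by (metis fg(1) iso)
  fix l u :: 'a assume le: "\<And>b. b \<in> Basis \<Longrightarrow> l \<bullet> b \<le> u \<bullet> b"
  have vim: "f -` box l u = g ` box l u" using fg by (auto simp: image_iff) metis
  have op: "open (f -` box l u)"
    by (intro open_vimage open_box linear_continuous_on) (simp add: lin linear_linear)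
  have "emeasure lebesgue (g ` box l u) \<le> emeasure lebesgue (box l u)"
    by (rule emeasure_isometry_le[OF g(1) isog open_box])
  moreover have "emeasure lebesgue (f ` (f -` box l u)) \<le> emeasure lebesgue (f -` box l u)"
    by (rule emeasure_isometry_le[OF lin iso op])
  moreover have "f ` (f -` box l u) = box l u" using fg by (auto simp: image_iff) metis
  ultimately have "emeasure lebesgue (f -` box l u) = emeasure lebesgue (box l u)"
    using vim by simp
  then have "emeasure lborel (f -` box l u) = emeasure lborel (box l u)"
    using op by (simp add: borel_open)
  then show "emeasure (distr lborel borel f) (box l u) = (\<Prod>b\<in>Basis. (u - l) \<bullet> b)"
    using le by (simp add: emeasure_distr emeasure_lborel_box)
qed simp

section \<open>Series over multi-indices\<close>

lemma mpow_pos: "r \<in> pos_vecs \<Longrightarrow> 0 < mpow r \<alpha>" for r :: "real ^ 'd::finite"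
  by (simp add: pos_vecs_def mpow_def prod_pos)

lemma mpow_mult: "mpow (\<chi> j. x $ j * y $ j) \<alpha> = mpow x \<alpha> * mpow y \<alpha>"
  by (simp add: mpow_def power_mult_distrib prod.distrib)

lemma mpow_divide: "mpow (\<chi> j. x $ j / y $ j) \<alpha> = mpow x \<alpha> / mpow y \<alpha>"
  for x :: "'a::field ^ 'd::finite"
  by (simp add: mpow_def power_divide prod_dividef)

lemma norm_mpow: "norm (mpow z \<alpha>) = mpow (\<chi> j. norm (z $ j)) \<alpha>"
  for z :: "'a::real_normed_field ^ 'd::finite"
  unfolding mpow_def prod_norm[symmetric] by (simp add: norm_power)

lemma mpow_mono:
  fixes x y :: "real ^ 'd::finite"
  assumes "\<And>j. 0 \<le> x $ j" "\<And>j. x $ j \<le> y $ j"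
  shows "mpow x \<alpha> \<le> mpow y \<alpha>"
  unfolding mpow_def using assms by (intro prod_mono) (auto intro: power_mono)

lemma mpow_cnj: "mpow (\<chi> j. cnj (z $ j)) \<alpha> = cnj (mpow z \<alpha>)"
  by (simp add: mpow_def)

lemma mpow_of_real: "mpow (\<chi> j. complex_of_real (r $ j)) \<alpha> = of_real (mpow r \<alpha>)"
  by (simp add: mpow_def)

lemma mfact_pos [simp]: "0 < mfact \<alpha>"
  by (simp add: mfact_def prod_pos)

lemma mfact_nonneg [simp]: "0 \<le> mfact \<alpha>" and mfact_nonzero [simp]: "mfact \<alpha> \<noteq> 0"
  using mfact_pos[of \<alpha>] by linarith+

lemma continuous_on_mpow [continuous_intros]:
  fixes f :: "'b::topological_space \<Rightarrow> complex ^ 'd::finite"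
  shows "continuous_on S f \<Longrightarrow> continuous_on S (\<lambda>z. mpow (f z) \<alpha>)"
  unfolding mpow_def by (intro continuous_intros)

lemma compact_closed_polydisc:
  "compact {w :: complex ^ 'd::finite. \<forall>j. cmod (w $ j) \<le> R $ j}" (is "compact ?D")
proof -
  have "norm w \<le> (\<Sum>j\<in>UNIV. R $ j)" if "w \<in> ?D" for w
    unfolding norm_vec_def by (rule order_trans[OF L2_set_le_sum sum_mono]) (use that in auto)
  then have "bounded ?D" by (rule boundedI)
  moreover have "closed ?D" by (intro closed_Collect_all closed_Collect_le continuous_intros)
  ultimately show ?thesis by (simp add: compact_eq_bounded_closed)
qed

text \<open>Distributivity for absolutely convergent series: a multi-index is a choice of one term
  from each factor, that is, an element of \<open>PiE UNIV (\<lambda>_. UNIV)\<close>.\<close>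

lemma has_sum_prod_multiindex:
  fixes f :: "'d::finite \<Rightarrow> nat \<Rightarrow> 'c::{real_normed_field, banach, second_countable_topology}"
  assumes summable: "\<And>j. summable (\<lambda>n. norm (f j n))" and sums: "\<And>j. f j sums s j"
  shows "((\<lambda>\<alpha>. \<Prod>j\<in>UNIV. f j (\<alpha> j)) has_sum (\<Prod>j\<in>UNIV. s j)) UNIV"
proof -
  have abs: "Infinite_Set_Sum.abs_summable_on (f j) UNIV" for j
    using summable by (simp add: abs_summable_on_nat_iff')
  have "Infinite_Set_Sum.abs_summable_on (\<lambda>\<alpha>. \<Prod>j\<in>UNIV. f j (\<alpha> j)) (PiE UNIV (\<lambda>_. UNIV))"
    by (intro abs_summable_on_prod_PiE abs) auto
  then have "Infinite_Sum.abs_summable_on (\<lambda>\<alpha>. \<Prod>j\<in>UNIV. f j (\<alpha> j)) UNIV"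
    by (simp add: PiE_UNIV_domain abs_summable_equivalent)
  then have "(\<lambda>\<alpha>. \<Prod>j\<in>UNIV. f j (\<alpha> j)) summable_on UNIV"
    by (rule abs_summable_summable)
  moreover have "infsum (\<lambda>\<alpha>. \<Prod>j\<in>UNIV. f j (\<alpha> j)) (PiE UNIV (\<lambda>_. UNIV))
      = (\<Prod>j\<in>UNIV. infsum (f j) UNIV)"
    by (rule infsum_prod_PiE_abs) (use abs in \<open>auto simp: abs_summable_equivalent\<close>)
  moreover have "infsum (f j) UNIV = s j" for j
    using norm_summable_imp_has_sum[OF summable sums] by (simp add: infsumI)
  ultimately show ?thesis
    using has_sum_infsum[of "\<lambda>\<alpha>. \<Prod>j\<in>UNIV. f j (\<alpha> j)" UNIV] by (simp add: PiE_UNIV_domain)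
qed

lemma has_sum_exp_multiindex:
  fixes x :: "'a::{real_normed_field, banach, second_countable_topology} ^ 'd::finite"
  shows "((\<lambda>\<alpha>. mpow x \<alpha> / of_real (mfact \<alpha>)) has_sum exp (\<Sum>j\<in>UNIV. x $ j)) UNIV"
proof -
  have "((\<lambda>\<alpha>. \<Prod>j\<in>UNIV. x $ j ^ \<alpha> j /\<^sub>R fact (\<alpha> j)) has_sum (\<Prod>j\<in>UNIV. exp (x $ j))) UNIV"
  proof (rule has_sum_prod_multiindex)
    show "summable (\<lambda>n. norm (x $ j ^ n /\<^sub>R fact n))" for j
      using summable_norm_exp[of "x $ j"] by (simp add: norm_power scaleR_conv_of_real)
    show "(\<lambda>n. x $ j ^ n /\<^sub>R fact n) sums exp (x $ j)" for j by (rule exp_converges)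
  qed
  moreover have "(\<Prod>j\<in>UNIV. x $ j ^ \<alpha> j /\<^sub>R fact (\<alpha> j)) = mpow x \<alpha> / of_real (mfact \<alpha>)" for \<alpha>
    by (simp add: mpow_def mfact_def scaleR_conv_of_real divide_inverse prod.distrib
          flip: prod_inversef)
  ultimately show ?thesis by (simp add: exp_sum)
qed

lemma has_sum_geometric_multiindex:
  fixes q :: "'a::{real_normed_field, banach, second_countable_topology} ^ 'd::finite"
  assumes "\<And>j. norm (q $ j) < 1"
  shows "((\<lambda>\<alpha>. mpow q \<alpha>) has_sum (\<Prod>j\<in>UNIV. 1 / (1 - q $ j))) UNIV"
  unfolding mpow_def
  by (rule has_sum_prod_multiindex[where f = "\<lambda>j n. q $ j ^ n"])
     (use assms in \<open>auto simp: norm_power intro!: summable_geometric geometric_sums\<close>)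

text \<open>The integral of the tail of the series is at most the tail of \<open>M\<close> times the integral of
  \<open>g\<close>; no countability of the index set is needed.\<close>

lemma has_sum_integral_dominated:
  fixes f :: "'i \<Rightarrow> 'a \<Rightarrow> complex"
  assumes M: "M summable_on UNIV" and g: "integrable \<mu> g"
    and f: "\<And>i. f i \<in> borel_measurable \<mu>" and s: "s \<in> borel_measurable \<mu>"
    and ae: "AE w in \<mu>. 0 \<le> g w \<and> (\<forall>i. norm (f i w) \<le> M i * g w) \<and> ((\<lambda>i. f i w) has_sum s w) UNIV"
  shows "((\<lambda>i. \<integral>w. f i w \<partial>\<mu>) has_sum (\<integral>w. s w \<partial>\<mu>)) UNIV"
proof (cases "AE w in \<mu>. g w = 0")
  case True
  have "AE w in \<mu>. f i w = 0" for i
    using ae True by eventually_elim (metis mult_zero_right norm_le_zero_iff)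
  moreover have "AE w in \<mu>. s w = 0"
    using ae True
  proof eventually_elim
    case (elim w)
    then have "f i w = 0" for i by (metis mult_zero_right norm_le_zero_iff)
    then show ?case using elim has_sum_0 has_sum_unique by (metis (mono_tags, lifting))
  qed
  ultimately show ?thesis by (simp cong: integral_cong_AE add: integral_eq_zero_AE)
next
  case False
  have Mpos: "0 \<le> M i" for i
  proof (rule ccontr)
    assume "\<not> 0 \<le> M i"
    have "AE w in \<mu>. g w = 0"
      using ae
    proof eventually_elim
      case (elim w)
      then have "0 \<le> M i * g w" by (meson norm_ge_zero order_trans)
      then show ?case using elim \<open>\<not> 0 \<le> M i\<close> by (simp add: zero_le_mult_iff)
    qed
    then show False using False by blast
  qed
  have tail: "norm (s w - (\<Sum>i\<in>A. f i w)) \<le> infsum M (UNIV - A) * g w"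
    if w: "0 \<le> g w" "\<forall>i. norm (f i w) \<le> M i * g w" "((\<lambda>i. f i w) has_sum s w) UNIV" and A: "finite A"
    for w A
  proof -
    have "((\<lambda>i. f i w) has_sum (s w - (\<Sum>i\<in>A. f i w))) (UNIV - A)"
      using w(3) A by (intro has_sum_Diff) (auto simp: has_sum_finite)
    moreover have "((\<lambda>i. M i * g w) has_sum (infsum M (UNIV - A) * g w)) (UNIV - A)"
      using M by (intro has_sum_cmult_left has_sum_infsum) (rule summable_on_subset_banach, auto)
    ultimately show ?thesis by (rule norm_infsum_le) (use w(2) in auto)
  qed
  have int_f: "integrable \<mu> (f i)" for i
  proof (rule Bochner_Integration.integrable_bound[OF integrable_mult_right[OF g, of "M i"] f])
    show "AE w in \<mu>. norm (f i w) \<le> norm (M i * g w)"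
      using ae by eventually_elim (metis abs_of_nonneg norm_ge_zero order_trans real_norm_def)
  qed
  have int_s: "integrable \<mu> s"
  proof (rule Bochner_Integration.integrable_bound[OF integrable_mult_right[OF g, of "infsum M UNIV"] s])
    show "AE w in \<mu>. norm (s w) \<le> norm (infsum M UNIV * g w)"
      using ae
    proof eventually_elim
      case (elim w)
      then have "norm (s w) \<le> infsum M UNIV * g w" using tail[of w "{}"] by simp
      then show ?case by simp
    qed
  qed
  have bound: "norm ((\<Sum>i\<in>A. \<integral>w. f i w \<partial>\<mu>) - (\<integral>w. s w \<partial>\<mu>)) \<le> infsum M (UNIV - A) * (\<integral>w. g w \<partial>\<mu>)"
    if A: "finite A" for A
  proof -
    have int_d: "integrable \<mu> (\<lambda>w. s w - (\<Sum>i\<in>A. f i w))" using int_f int_s by auto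
    have "(\<integral>w. s w \<partial>\<mu>) - (\<Sum>i\<in>A. \<integral>w. f i w \<partial>\<mu>) = (\<integral>w. s w - (\<Sum>i\<in>A. f i w) \<partial>\<mu>)"
      using int_f int_s by (simp add: Bochner_Integration.integral_diff Bochner_Integration.integral_sum)
    also have "norm \<dots> \<le> (\<integral>w. norm (s w - (\<Sum>i\<in>A. f i w)) \<partial>\<mu>)" by (rule integral_norm_bound)
    also have "\<dots> \<le> (\<integral>w. infsum M (UNIV - A) * g w \<partial>\<mu>)"
    proof (intro integral_mono_AE integrable_norm int_d integrable_mult_right g)
      show "AE w in \<mu>. norm (s w - (\<Sum>i\<in>A. f i w)) \<le> infsum M (UNIV - A) * g w"
        using ae by eventually_elim (use tail A in blast)
    qed
    also have "\<dots> = infsum M (UNIV - A) * (\<integral>w. g w \<partial>\<mu>)" by simp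
    finally show ?thesis by (simp add: norm_minus_commute)
  qed
  have "((\<lambda>A. infsum M UNIV - sum M A) \<longlongrightarrow> infsum M UNIV - infsum M UNIV) (finite_subsets_at_top UNIV)"
    using has_sum_infsum[OF M] unfolding has_sum_def by (intro tendsto_intros)
  moreover have "eventually (\<lambda>A. infsum M UNIV - sum M A = infsum M (UNIV - A)) (finite_subsets_at_top UNIV)"
    using M by (intro eventually_finite_subsets_at_top_weakI) (simp add: infsum_Diff)
  ultimately have "((\<lambda>A. infsum M (UNIV - A)) \<longlongrightarrow> 0) (finite_subsets_at_top UNIV)"
    by (simp add: tendsto_cong)
  then have "((\<lambda>A. infsum M (UNIV - A) * (\<integral>w. g w \<partial>\<mu>)) \<longlongrightarrow> 0 * (\<integral>w. g w \<partial>\<mu>)) (finite_subsets_at_top UNIV)"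
    by (intro tendsto_intros)
  then have "((\<lambda>A. (\<Sum>i\<in>A. \<integral>w. f i w \<partial>\<mu>) - (\<integral>w. s w \<partial>\<mu>)) \<longlongrightarrow> 0) (finite_subsets_at_top UNIV)"
    by (rule_tac Lim_null_comparison) (use bound in \<open>auto intro!: eventually_finite_subsets_at_top_weakI\<close>)
  then show ?thesis
    unfolding has_sum_def by (simp add: LIM_zero_iff)
qed

section \<open>Rotation-invariant weights\<close>

definition rotate_coord :: "'d \<Rightarrow> complex \<Rightarrow> complex ^ 'd::finite \<Rightarrow> complex ^ 'd"
  where "rotate_coord j u z = (\<chi> k. if k = j then u * z $ k else z $ k)"

lemma lborel_distr_rotate:
  assumes "cmod u = 1"
  shows "distr lborel borel (rotate_coord j u) = (lborel :: (complex ^ 'd::finite) measure)"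
proof (rule lborel_distr_isometry)
  show "linear (rotate_coord j u :: complex ^ 'd \<Rightarrow> _)"
    by (rule linearI) (auto simp: rotate_coord_def vec_eq_iff algebra_simps)
  show "norm (rotate_coord j u z) = norm z" for z :: "complex ^ 'd"
    unfolding norm_vec_def rotate_coord_def by (intro L2_set_cong) (auto simp: norm_mult assms)
qed

lemma measurable_rotate [measurable]: "rotate_coord j u \<in> borel_measurable borel"
proof -
  have "continuous_on UNIV (\<lambda>x. if k = j then u * x $ k else x $ k)" for k
    by (cases "k = j") (simp_all add: continuous_intros)
  then show ?thesis
    unfolding rotate_coord_def by (intro borel_measurable_continuous_onI continuous_on_vec_lambda)
qed

lemma borel_measurable_cnj [measurable (raw)]:
  "f \<in> borel_measurable M \<Longrightarrow> (\<lambda>w. cnj (f w)) \<in> borel_measurable M"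
  by (rule borel_measurable_continuous_on[of cnj]) (intro continuous_intros)

lemma borel_measurable_mpow [measurable]:
  "(\<lambda>w. mpow w \<alpha>) \<in> borel_measurable (borel :: (complex ^ 'd::finite) measure)"
  by (intro borel_measurable_continuous_onI continuous_intros)

lemma mpow_rotate: "mpow (rotate_coord j u w) \<alpha> = u ^ \<alpha> j * mpow w \<alpha>"
proof -
  have "mpow (rotate_coord j u w) \<alpha> = (\<Prod>k\<in>UNIV. (if k = j then u ^ \<alpha> k else 1) * (w $ k) ^ \<alpha> k)"
    unfolding mpow_def rotate_coord_def by (intro prod.cong) (auto simp: power_mult_distrib)
  then show ?thesis by (simp add: prod.distrib mpow_def)
qed

text \<open>Two instances are intended: the density built from an element of \<open>R_infty\<close>,
  with the Gaussian and the power of pi absorbed, and the indicator of a closed polydisc, which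
  yields uniqueness of power series coefficients. The conditions hold almost everywhere because the
  first instance stems from a class of functions.\<close>

locale reinhardt_weight =
  fixes g :: "complex ^ 'd::finite \<Rightarrow> real" and R :: "real ^ 'd"
  assumes integrable_weight: "integrable lborel g"
    and weight_nonneg: "AE w in lborel. 0 \<le> g w"
    and weight_support: "AE w in lborel. g w = 0 \<or> (\<forall>j. cmod (w $ j) \<le> R $ j)"
    and weight_radial: "\<exists>g0 :: real ^ 'd \<Rightarrow> real. AE w in lborel. g w = g0 (\<chi> j. cmod (w $ j))"
    and R_pos: "R \<in> pos_vecs"
begin

definition moment :: "('d \<Rightarrow> nat) \<Rightarrow> real"
  where "moment \<beta> = (\<integral>w. g w * (cmod (mpow w \<beta>))\<^sup>2 \<partial>lborel)"

lemma measurable_weight [measurable]: "g \<in> borel_measurable borel"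
  using borel_measurable_integrable[OF integrable_weight] by simp

lemma norm_mpow_le:
  assumes "\<forall>j. cmod (w $ j) \<le> R $ j"
  shows "cmod (mpow w \<alpha>) \<le> mpow R \<alpha>"
  unfolding norm_mpow by (rule mpow_mono) (use assms in auto)

text \<open>The radial form is given only off a null set and \<open>g0\<close> need not be
  measurable, so it is the almost-everywhere statement that is pulled back along the
  measure-preserving rotation.\<close>

lemma weight_rotate:
  assumes "cmod u = 1"
  shows "AE w in lborel. g (rotate_coord j u w) = g w"
proof -
  obtain g0 :: "real ^ 'd \<Rightarrow> real" where g0: "AE w in lborel. g w = g0 (\<chi> j. cmod (w $ j))"
    using weight_radial by blast
  have "AE w in lborel. g (rotate_coord j u w) = g0 (\<chi> k. cmod (rotate_coord j u w $ k))"
  proof (rule AE_distrD[of "rotate_coord j u" lborel borel])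
    show "AE w in distr lborel borel (rotate_coord j u). g w = g0 (\<chi> j. cmod (w $ j))"
      unfolding lborel_distr_rotate[OF assms] by (rule g0)
  qed simp
  moreover have "(\<chi> k. cmod (rotate_coord j u w $ k)) = (\<chi> k. cmod (w $ k))" for w :: "complex ^ 'd"
    by (simp add: rotate_coord_def vec_eq_iff norm_mult assms)
  ultimately have "AE w in lborel. g (rotate_coord j u w) = g0 (\<chi> k. cmod (w $ k))" by simp
  with g0 show ?thesis by eventually_elim simp
qed

text \<open>Rotating a coordinate in which the indices differ leaves the integral unchanged but
  multiplies the integrand by a constant of modulus one. With the right angle that constant is -1,
  so the integral equals its own negative.\<close>

lemma monomials_orthogonal:
  assumes "\<alpha> \<noteq> \<beta>"
  shows "(\<integral>w. g w *\<^sub>R (mpow w \<alpha> * cnj (mpow w \<beta>)) \<partial>lborel) = 0" (is "?I = 0")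
proof -
  obtain j where j: "\<alpha> j \<noteq> \<beta> j" using assms by auto
  \<comment> \<open>Chosen so that \<open>(\<alpha> j - \<beta> j) * t\<close> is pi, whichever of
    the two exponents is larger.\<close>
  define t where "t = pi / (real (\<alpha> j) - real (\<beta> j))"
  define u where "u = cis t"
  have u: "cmod u = 1" by (simp add: u_def)
  have "u ^ \<alpha> j * cnj (u ^ \<beta> j) = cis (real (\<alpha> j) * t - real (\<beta> j) * t)"
    by (simp add: u_def cis_cnj Complex.DeMoivre cis_mult del: complex_cnj_power flip: diff_conv_add_uminus)
  also have "real (\<alpha> j) * t - real (\<beta> j) * t = (real (\<alpha> j) - real (\<beta> j)) * t"
    by (simp add: left_diff_distrib)
  also have "\<dots> = pi" using j by (simp add: t_def)
  finally have u_minus1: "u ^ \<alpha> j * cnj (u ^ \<beta> j) = - 1" by simp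
  let ?f = "\<lambda>w. g w *\<^sub>R (mpow w \<alpha> * cnj (mpow w \<beta>))"
  have "?I = (\<integral>w. ?f w \<partial>distr lborel borel (rotate_coord j u))"
    by (simp add: lborel_distr_rotate[OF u])
  also have "\<dots> = (\<integral>w. ?f (rotate_coord j u w) \<partial>lborel)"
    by (rule integral_distr) simp_all
  also have "\<dots> = (\<integral>w. - ?f w \<partial>lborel)"
  proof (rule integral_cong_AE)
    show "AE w in lborel. ?f (rotate_coord j u w) = - ?f w"
      using weight_rotate[OF u, of j]
    proof eventually_elim
      case (elim w)
      have "mpow (rotate_coord j u w) \<alpha> * cnj (mpow (rotate_coord j u w) \<beta>)
          = (u ^ \<alpha> j * cnj (u ^ \<beta> j)) * (mpow w \<alpha> * cnj (mpow w \<beta>))"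
        by (simp add: mpow_rotate)
      then show ?case unfolding elim u_minus1 by simp
    qed
  qed simp_all
  finally show ?thesis by simp
qed

lemma integrable_weight_mult:
  fixes F :: "complex ^ 'd \<Rightarrow> complex"
  assumes "F \<in> borel_measurable borel" and "\<And>w. \<forall>j. cmod (w $ j) \<le> R $ j \<Longrightarrow> cmod (F w) \<le> B"
  shows "integrable lborel (\<lambda>w. g w *\<^sub>R F w)"
proof (rule Bochner_Integration.integrable_bound[OF integrable_mult_right[OF integrable_weight, of B]])
  show "AE w in lborel. norm (g w *\<^sub>R F w) \<le> norm (B * g w)"
    using weight_support
  proof eventually_elim
    case (elim w)
    then show ?case
    proof
      assume "\<forall>j. cmod (w $ j) \<le> R $ j"
      then have "cmod (F w) \<le> \<bar>B\<bar>" using assms(2) by fastforce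
      then show ?thesis using mult_left_mono[of "cmod (F w)" "\<bar>B\<bar>" "\<bar>g w\<bar>"]
        by (simp add: abs_mult mult.commute)
    qed simp
  qed
qed (use assms(1) in simp)

text \<open>Termwise integration against the conjugate monomial leaves only the term of index
  \<beta>, by orthogonality. Convergence is required only on the closed polydisc carrying the
  weight, so the lemma also serves for local expansions.\<close>

lemma integral_weight_power_series:
  assumes F: "F \<in> borel_measurable borel"
    and sum: "\<And>w. \<forall>j. cmod (w $ j) \<le> R $ j \<Longrightarrow> ((\<lambda>\<alpha>. a \<alpha> * mpow w \<alpha>) has_sum F w) UNIV"
  shows "(\<integral>w. g w *\<^sub>R (F w * cnj (mpow w \<beta>)) \<partial>lborel) = a \<beta> * of_real (moment \<beta>)"
proof -
  let ?f = "\<lambda>\<alpha> w. g w *\<^sub>R (a \<alpha> * mpow w \<alpha> * cnj (mpow w \<beta>))"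
  have "((\<lambda>\<alpha>. \<integral>w. ?f \<alpha> w \<partial>lborel) has_sum (\<integral>w. g w *\<^sub>R (F w * cnj (mpow w \<beta>)) \<partial>lborel)) UNIV"
  proof (rule has_sum_integral_dominated[OF _ integrable_weight])
    \<comment> \<open>Convergence at the corner point R of the polydisc is automatically absolute,
      and its terms dominate those at every other point of the support.\<close>
    have "(\<lambda>\<alpha>. a \<alpha> * mpow (\<chi> j. complex_of_real (R $ j)) \<alpha>) summable_on UNIV"
      using R_pos by (intro has_sum_imp_summable[OF sum]) (auto simp: pos_vecs_def less_imp_le)
    then have "(\<lambda>\<alpha>. norm (a \<alpha> * mpow (\<chi> j. complex_of_real (R $ j)) \<alpha>)) summable_on UNIV"
      by (simp only: summable_on_iff_abs_summable_on_complex)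
    then have "(\<lambda>\<alpha>. cmod (a \<alpha>) * mpow R \<alpha>) summable_on UNIV"
      using mpow_pos[OF R_pos] by (simp add: mpow_of_real norm_mult less_imp_le)
    then show "(\<lambda>\<alpha>. cmod (a \<alpha>) * mpow R \<alpha> * mpow R \<beta>) summable_on UNIV"
      by (rule summable_on_cmult_left)
    show "AE w in lborel. 0 \<le> g w \<and> (\<forall>i. cmod (?f i w) \<le> cmod (a i) * mpow R i * mpow R \<beta> * g w) \<and>
        ((\<lambda>i. ?f i w) has_sum g w *\<^sub>R (F w * cnj (mpow w \<beta>))) UNIV"
      using weight_nonneg weight_support
    proof eventually_elim
      case (elim w)
      show ?case
      proof (cases "g w = 0")
        case False
        then have w: "\<forall>j. cmod (w $ j) \<le> R $ j" using elim by blast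
        have "cmod (mpow w \<alpha>) * cmod (mpow w \<beta>) \<le> mpow R \<alpha> * mpow R \<beta>" for \<alpha>
          by (intro mult_mono norm_mpow_le w) (auto intro: less_imp_le mpow_pos R_pos)
        then have "cmod (a \<alpha>) * (cmod (mpow w \<alpha>) * cmod (mpow w \<beta>)) * g w
            \<le> cmod (a \<alpha>) * (mpow R \<alpha> * mpow R \<beta>) * g w" for \<alpha>
          using elim(1) by (intro mult_right_mono mult_left_mono) auto
        then have "cmod (?f \<alpha> w) \<le> cmod (a \<alpha>) * mpow R \<alpha> * mpow R \<beta> * g w" for \<alpha>
          using elim(1) by (simp add: norm_mult mult_ac)
        moreover have "((\<lambda>\<alpha>. ?f \<alpha> w) has_sum g w *\<^sub>R (F w * cnj (mpow w \<beta>))) UNIV"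
          unfolding scaleR_conv_of_real by (intro has_sum_cmult_right has_sum_cmult_left sum w)
        ultimately show ?thesis using elim(1) by blast
      qed simp
    qed
  qed (use F in simp_all)
  moreover have "(\<integral>w. ?f \<alpha> w \<partial>lborel) = (if \<alpha> = \<beta> then a \<beta> * of_real (moment \<beta>) else 0)" for \<alpha>
  proof -
    have "(\<integral>w. ?f \<alpha> w \<partial>lborel) = (\<integral>w. a \<alpha> * (g w *\<^sub>R (mpow w \<alpha> * cnj (mpow w \<beta>))) \<partial>lborel)"
      by (simp add: mult.assoc)
    also have "\<dots> = a \<alpha> * (\<integral>w. g w *\<^sub>R (mpow w \<alpha> * cnj (mpow w \<beta>)) \<partial>lborel)"
      by (rule integral_mult_right_zero)
    also have "\<dots> = (if \<alpha> = \<beta> then a \<beta> * of_real (moment \<beta>) else 0)"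
    proof (cases "\<alpha> = \<beta>")
      case True
      have "(\<integral>w. g w *\<^sub>R (mpow w \<beta> * cnj (mpow w \<beta>)) \<partial>lborel) = of_real (moment \<beta>)"
        unfolding moment_def integral_complex_of_real[symmetric]
        by (simp add: scaleR_conv_of_real complex_norm_square[symmetric])
      then show ?thesis using True by simp
    qed (simp add: monomials_orthogonal)
    finally show ?thesis .
  qed
  ultimately have "((\<lambda>\<alpha>. if \<alpha> = \<beta> then a \<beta> * of_real (moment \<beta>) else 0) has_sum
      (\<integral>w. g w *\<^sub>R (F w * cnj (mpow w \<beta>)) \<partial>lborel)) UNIV" by simp
  moreover have "((\<lambda>\<alpha>. if \<alpha> = \<beta> then a \<beta> * of_real (moment \<beta>) else 0) has_sum a \<beta> * of_real (moment \<beta>)) UNIV"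
    by (rule has_sum_finite_neutralI[of "{\<beta>}"]) auto
  ultimately show ?thesis by (rule has_sum_unique)
qed

lemma integrable_moment: "integrable lborel (\<lambda>w. g w * (cmod (mpow w \<beta>))\<^sup>2)"
proof -
  have "integrable lborel (\<lambda>w. norm (g w *\<^sub>R complex_of_real ((cmod (mpow w \<beta>))\<^sup>2)))"
    by (intro integrable_norm integrable_weight_mult[of _ "(mpow R \<beta>)\<^sup>2"])
      (auto simp: norm_power intro!: power_mono norm_mpow_le)
  then show ?thesis
    by (rule integrable_cong_AE_imp) (use weight_nonneg in \<open>simp, eventually_elim, simp add: norm_power\<close>)
qed

lemma moment_le: "moment \<beta> \<le> (mpow R \<beta>)\<^sup>2 * (\<integral>w. g w \<partial>lborel)"
proof -
  have "moment \<beta> \<le> (\<integral>w. (mpow R \<beta>)\<^sup>2 * g w \<partial>lborel)"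
    unfolding moment_def
  proof (intro integral_mono_AE integrable_moment integrable_mult_right integrable_weight)
    show "AE w in lborel. g w * (cmod (mpow w \<beta>))\<^sup>2 \<le> (mpow R \<beta>)\<^sup>2 * g w"
      using weight_nonneg weight_support
    proof eventually_elim
      case (elim w)
      show ?case
      proof (cases "g w = 0")
        case False
        then have "cmod (mpow w \<beta>) \<le> mpow R \<beta>" using elim(2) norm_mpow_le by blast
        then show ?thesis using elim(1) by (simp add: mult.commute mult_left_mono power_mono)
      qed simp
    qed
  qed
  then show ?thesis by simp
qed

text \<open>The integral is restricted to the shell where every |w_j| lies between t_j/2 and t_j.
  There |w^\<beta>| is at least (t/2)^\<beta>, and the measure of the shell is a positive number
  independent of \<beta>.\<close>

lemma moment_ge:
  assumes t: "t \<in> pos_vecs" and "0 < c" and ge: "AE w in lborel. w \<in> polydisc t \<longrightarrow> c \<le> g w"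
  shows "\<exists>K>0. \<forall>\<beta>. K * (mpow ((1/2) *\<^sub>R t) \<beta>)\<^sup>2 \<le> moment \<beta>"
proof -
  define S where "S = {w :: complex ^ 'd. \<forall>j. cmod (w $ j) \<in> {t $ j / 2 <..< t $ j}}"
  have S_eq: "S = (\<Inter>j. (\<lambda>w. cmod (w $ j)) -` {t $ j / 2 <..< t $ j})" by (auto simp: S_def)
  have "open S" unfolding S_eq
    by (intro open_INT finite ballI open_vimage open_greaterThanLessThan continuous_intros)
  have "(\<chi> j. complex_of_real (3/4 * t $ j)) \<in> S"
    using t by (simp add: S_def pos_vecs_def norm_mult) (simp add: abs_of_pos)
  then have "S \<noteq> {}" by blast
  have "norm w \<le> (\<Sum>j\<in>UNIV. t $ j)" if "w \<in> S" for w
    unfolding norm_vec_def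
    by (rule order_trans[OF L2_set_le_sum sum_mono]) (use that in \<open>auto simp: S_def less_imp_le\<close>)
  then have "bounded S" by (rule boundedI)
  then have fin: "emeasure lborel S < \<infinity>" by (rule emeasure_bounded_finite)
  have S_sets [measurable]: "S \<in> sets borel" using \<open>open S\<close> by simp
  have "emeasure lborel S \<noteq> 0"
    using \<open>open S\<close> \<open>S \<noteq> {}\<close> open_not_negligible[of S]
    by (auto simp: negligible_iff_null_sets null_sets_def)
  then have S_pos: "0 < measure lborel S"
    using fin by (simp add: measure_def enn2real_positive_iff less_top zero_less_iff_neq_zero)
  have "c * measure lborel S * (mpow ((1/2) *\<^sub>R t) \<beta>)\<^sup>2 \<le> moment \<beta>" for \<beta>
  proof -
    have "(\<integral>w. c * (mpow ((1/2) *\<^sub>R t) \<beta>)\<^sup>2 * indicator S w \<partial>lborel) \<le> moment \<beta>"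
      unfolding moment_def
    proof (intro integral_mono_AE integrable_moment integrable_mult_right)
      show "AE w in lborel. c * (mpow ((1/2) *\<^sub>R t) \<beta>)\<^sup>2 * indicator S w \<le> g w * (cmod (mpow w \<beta>))\<^sup>2"
        using weight_nonneg ge
      proof eventually_elim
        case (elim w)
        show ?case
        proof (cases "w \<in> S")
          case True
          then have "w \<in> polydisc t" by (auto simp: S_def polydisc_def)
          moreover have "mpow ((1/2) *\<^sub>R t) \<beta> \<le> cmod (mpow w \<beta>)"
            unfolding norm_mpow
            by (rule mpow_mono) (use True t in \<open>auto simp: S_def pos_vecs_def less_imp_le\<close>)
          moreover have "0 < mpow ((1/2) *\<^sub>R t) \<beta>"
            by (rule mpow_pos) (use t in \<open>simp add: pos_vecs_def\<close>)
          ultimately show ?thesis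
            using elim True \<open>0 < c\<close> by (simp, intro mult_mono power_mono) auto
        qed (use elim in auto)
      qed
    qed (use fin in \<open>simp add: integrable_indicator_iff\<close>)
    then show ?thesis by (simp add: mult_ac)
  qed
  then show ?thesis using S_pos \<open>0 < c\<close> by (intro exI[of _ "c * measure lborel S"]) auto
qed

end

lemma reinhardt_weight_polydisc:
  assumes "R \<in> pos_vecs"
  shows "reinhardt_weight (indicator {w :: complex ^ 'd::finite. \<forall>j. cmod (w $ j) \<le> R $ j}) R"
proof
  let ?S = "{w :: complex ^ 'd. \<forall>j. cmod (w $ j) \<le> R $ j}"
  have "compact ?S" by (rule compact_closed_polydisc)
  then show "integrable lborel (indicator ?S :: _ \<Rightarrow> real)"
    using emeasure_bounded_finite[OF compact_imp_bounded, of ?S]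
    by (simp add: integrable_indicator_iff borel_compact)
  show "\<exists>g0 :: real ^ 'd \<Rightarrow> real. AE w in lborel. indicator ?S w = g0 (\<chi> j. cmod (w $ j))"
    by (intro exI[of _ "indicator {x. \<forall>j. x $ j \<le> R $ j}"] AE_I2) (auto simp: indicator_def)
qed (use assms in \<open>auto simp: indicator_def\<close>)

text \<open>Pairing the difference of the two series with the conjugate of w^\<beta> over the
  polydisc isolates the difference of the \<beta>-th coefficients, times a positive moment. Any
  polydisc will do, however small, so expansions found on different polydiscs can be
  compared.\<close>

lemma power_series_coefficients_unique:
  assumes R: "R \<in> pos_vecs"
    and a: "\<And>w. \<forall>j. cmod (w $ j) \<le> R $ j \<Longrightarrow> ((\<lambda>\<alpha>. a \<alpha> * mpow w \<alpha>) has_sum F w) UNIV"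
    and b: "\<And>w. \<forall>j. cmod (w $ j) \<le> R $ j \<Longrightarrow> ((\<lambda>\<alpha>. b \<alpha> * mpow w \<alpha>) has_sum F w) UNIV"
  shows "a = b"
proof
  fix \<beta>
  let ?g = "indicator {w. \<forall>j. cmod (w $ j) \<le> R $ j} :: _ \<Rightarrow> real"
  interpret reinhardt_weight ?g R by (rule reinhardt_weight_polydisc[OF R])
  have "((\<lambda>\<alpha>. (a \<alpha> - b \<alpha>) * mpow w \<alpha>) has_sum 0) UNIV" if "\<forall>j. cmod (w $ j) \<le> R $ j" for w
    using has_sum_add[OF a[OF that] has_sum_uminusI[OF b[OF that]]] by (simp add: left_diff_distrib)
  then have "0 = (a \<beta> - b \<beta>) * of_real (moment \<beta>)"
    using integral_weight_power_series[of "\<lambda>_. 0" "\<lambda>\<alpha>. a \<alpha> - b \<alpha>" \<beta>] by simp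
  moreover have "0 < moment \<beta>"
  proof -
    obtain K where "K > 0" "K * (mpow ((1/2) *\<^sub>R R) \<beta>)\<^sup>2 \<le> moment \<beta>"
      using moment_ge[OF R, of 1] by (auto simp: polydisc_def less_imp_le)
    moreover have "0 < mpow ((1/2) *\<^sub>R R) \<beta>"
      by (rule mpow_pos) (use R in \<open>simp add: pos_vecs_def\<close>)
    ultimately show ?thesis by (smt (verit) mult_pos_pos zero_less_power)
  qed
  ultimately show "a \<beta> = b \<beta>" by simp
qed

section \<open>Cauchy's integral formula on a torus\<close>

definition circ :: "real \<Rightarrow> complex"
  where "circ t = exp (2 * of_real pi * \<i> * of_real t)"

lemma norm_circ [simp]: "cmod (circ t) = 1"
  by (simp add: circ_def norm_exp_eq_Re)

lemma circ_nonzero [simp]: "circ t \<noteq> 0"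
  by (simp add: circ_def)

lemma continuous_on_circ [continuous_intros]: "continuous_on S circ"
  unfolding circ_def by (intro continuous_intros)

lemma borel_measurable_circ [measurable]: "circ \<in> borel_measurable borel"
  by (intro borel_measurable_continuous_onI continuous_intros)

text \<open>With w = r \<open>circ t\<close> one has dw = 2 pi i w dt, so Cauchy's formula becomes
  an average over a probability measure. Its product over the coordinates is again a probability
  measure, for which bounded measurable functions are integrable.\<close>

definition unit_interval_measure :: "real measure"
  where "unit_interval_measure = density lborel (indicator {0..1})"

lemma sets_unit_interval_measure [measurable_cong, simp]: "sets unit_interval_measure = sets borel"
  by (simp add: unit_interval_measure_def)

lemma prob_space_unit_interval_measure: "prob_space unit_interval_measure"
  by (rule prob_spaceI) (simp add: unit_interval_measure_def emeasure_density)

text \<open>The expression is w/(w - z) at w = r \<open>circ t\<close>: the Cauchy kernel after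
  dw/(2 pi i w) has been turned into dt. The bound is uniform in t.\<close>

lemma geometric_kernel_bound:
  fixes z :: complex
  assumes "cmod z < r"
  shows "1 - z / (of_real r * circ t) \<noteq> 0"
    and "cmod (1 / (1 - z / (of_real r * circ t))) \<le> 1 / (1 - cmod z / r)"
proof -
  have "r > 0" using assms by (meson norm_ge_zero order_le_less_trans)
  then have n: "cmod (z / (of_real r * circ t)) = cmod z / r" by (simp add: norm_divide norm_mult)
  have "1 - cmod z / r \<le> cmod (1 - z / (of_real r * circ t))"
    using norm_triangle_ineq2[of 1 "z / (of_real r * circ t)"] unfolding n by simp
  moreover have "0 < 1 - cmod z / r" using assms \<open>r > 0\<close> by simp
  ultimately have "0 < 1 - cmod z / r" "0 < cmod (1 - z / (of_real r * circ t))"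
    and "1 - cmod z / r \<le> cmod (1 - z / (of_real r * circ t))" by linarith+
  then show "1 - z / (of_real r * circ t) \<noteq> 0"
    and "cmod (1 / (1 - z / (of_real r * circ t))) \<le> 1 / (1 - cmod z / r)"
    by (auto simp del: norm_zero simp add: norm_divide intro!: divide_left_mono mult_pos_pos)
qed

lemma Cauchy_integral_unit_interval:
  assumes f: "f holomorphic_on UNIV" and z: "cmod z < r"
  shows "f z = (\<integral>t. f (of_real r * circ t) * (1 / (1 - z / (of_real r * circ t))) \<partial>unit_interval_measure)"
proof -
  have r: "r > 0" using z by (meson norm_ge_zero order_le_less_trans)
  have contf: "continuous_on A f" for A
    using f by (meson holomorphic_on_imp_continuous_on holomorphic_on_subset subset_UNIV)
  let ?h = "\<lambda>t. f (of_real r * circ t) * (1 / (1 - z / (of_real r * circ t)))"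
  have contC: "continuous_on A ?h" for A
    by (intro continuous_intros continuous_on_compose2[OF contf[of UNIV]])
      (use r geometric_kernel_bound(1)[OF z] in auto)
  have "((\<lambda>u. f u / (u - z)) has_contour_integral (2 * of_real pi * \<i> * f z)) (circlepath 0 r)"
    by (rule Cauchy_integral_circlepath)
      (use contf f z in \<open>auto intro: holomorphic_on_subset\<close>)
  then have "((\<lambda>t. f (circlepath 0 r t) / (circlepath 0 r t - z)
        * vector_derivative (circlepath 0 r) (at t within {0..1}))
      has_integral (2 * of_real pi * \<i> * f z)) {0..1}"
    by (simp add: has_contour_integral_def)
  moreover have "f (circlepath 0 r t) / (circlepath 0 r t - z)
        * vector_derivative (circlepath 0 r) (at t within {0..1}) = (2 * of_real pi * \<i>) * ?h t"
    if "t \<in> {0..1}" for t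
  proof -
    have c: "circlepath 0 r t = of_real r * circ t" by (simp add: circlepath circ_def mult_ac)
    have d: "vector_derivative (circlepath 0 r) (at t within {0..1}) = 2 * of_real pi * \<i> * (of_real r * circ t)"
      using that by (simp add: vector_derivative_circlepath01 circ_def mult_ac)
    have "of_real r * circ t - z \<noteq> 0"
      using geometric_kernel_bound(1)[OF z, of t] r by auto
    then show ?thesis unfolding c d using r geometric_kernel_bound(1)[OF z, of t]
      by (simp add: divide_simps)
  qed
  ultimately have "((\<lambda>t. (2 * of_real pi * \<i>) * ?h t) has_integral (2 * of_real pi * \<i> * f z)) {0..1}"
    by (subst (asm) has_integral_cong) auto
  then have "((\<lambda>t. inverse (2 * of_real pi * \<i>) * ((2 * of_real pi * \<i>) * ?h t)) has_integral
      (inverse (2 * of_real pi * \<i>) * (2 * of_real pi * \<i> * f z))) {0..1}"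
    by (rule has_integral_mult_right)
  moreover have "inverse (2 * of_real pi * \<i>) * ((2 * of_real pi * \<i>) * x) = x" for x :: complex
    by (subst mult.assoc[symmetric], subst left_inverse) simp_all
  ultimately have "(?h has_integral f z) {0..1}" by (simp only:)
  moreover have "set_integrable lborel {0..1} ?h"
    by (rule borel_integrable_atLeastAtMost') (rule contC)
  then have "set_lebesgue_integral lborel {0..1} ?h = integral {0..1} ?h"
    by (rule set_borel_integral_eq_integral)
  moreover have "(\<integral>t. ?h t \<partial>unit_interval_measure) = set_lebesgue_integral lborel {0..1} ?h"
  proof -
    have "(\<integral>t. ?h t \<partial>density lborel (\<lambda>t. ennreal (indicator {0..1} t)))
        = (\<integral>t. indicator {0..1} t *\<^sub>R ?h t \<partial>lborel)"
      by (rule integral_density) (use borel_measurable_continuous_onI[OF contC] in auto)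
    then show ?thesis by (simp add: unit_interval_measure_def set_lebesgue_integral_def ennreal_indicator)
  qed
  ultimately show ?thesis by (simp add: integral_unique)
qed

lemma entire_continuous_on: "F \<in> entire \<Longrightarrow> continuous_on S F"
  unfolding entire_def
  by (auto intro!: continuous_at_imp_continuous_on intro: has_derivative_continuous)

lemma entire_bounded_on_polydisc:
  assumes "F \<in> entire"
  shows "\<exists>B. \<forall>w. (\<forall>j. cmod (w $ j) \<le> R $ j) \<longrightarrow> cmod (F w) \<le> B"
proof -
  have "compact (F ` {w. \<forall>j. cmod (w $ j) \<le> R $ j})"
    by (intro compact_continuous_image entire_continuous_on compact_closed_polydisc assms)
  then show ?thesis by (auto simp: bounded_iff dest!: compact_imp_bounded)
qed

lemma entire_holomorphic_coordinate:
  assumes "F \<in> entire"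
  shows "(\<lambda>u. F (\<chi> k. if k = i then u else v k)) holomorphic_on UNIV"
proof (rule holomorphic_onI)
  fix u
  let ?c = "\<lambda>u. \<chi> k. if k = i then u else v k"
  obtain F' where F': "(F has_derivative F') (at (?c u))" "\<And>a v. F' (a *s v) = a * F' v"
    using assms unfolding entire_def by blast
  have bl: "bounded_linear (\<lambda>u. u *s axis i (1::complex))"
    by (intro linear_conv_bounded_linear[THEN iffD1] linearI)
      (auto simp: vec_eq_iff axis_def algebra_simps)
  have eq: "?c = (\<lambda>u. (\<chi> k. if k = i then 0 else v k) + u *s axis i 1)"
    by (auto simp: vec_eq_iff axis_def)
  have "(?c has_derivative (\<lambda>u. u *s axis i 1)) (at u)"
    unfolding eq by (rule derivative_eq_intros bounded_linear_imp_has_derivative[OF bl] refl)+ simp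
  from diff_chain_at[OF this F'(1)]
  have "((\<lambda>u. F (?c u)) has_derivative (\<lambda>h. h * F' (axis i 1))) (at u)"
    by (simp add: o_def F'(2))
  then have "((\<lambda>u. F (?c u)) has_field_derivative F' (axis i 1)) (at u)"
    by (simp only: has_field_derivative_def mult_commute_abs)
  then show "(\<lambda>u. F (?c u)) field_differentiable at u within UNIV"
    by (auto simp: field_differentiable_def)
qed

lemma borel_measurable_vec_lambda [measurable (raw)]:
  fixes f :: "'d::finite \<Rightarrow> 'a \<Rightarrow> 'b::euclidean_space"
  assumes "\<And>j. f j \<in> borel_measurable M"
  shows "(\<lambda>x. \<chi> j. f j x) \<in> borel_measurable M"
  unfolding borel_measurable_euclidean_space[where f = "\<lambda>x. \<chi> j. f j x"]
proof
  fix b :: "'b ^ 'd" assume "b \<in> Basis"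
  then obtain j c where "b = axis j c" by (auto simp: Basis_vec_def)
  then show "(\<lambda>x. (\<chi> j. f j x) \<bullet> b) \<in> borel_measurable M"
    using assms by (simp add: inner_axis)
qed

context
  fixes R :: "real ^ 'd::finite"
begin

text \<open>Coordinates outside S stay at z. These mixed points allow an induction on the set of
  coordinates in which Cauchy's formula has already been applied.\<close>

definition torus_pt :: "'d set \<Rightarrow> complex ^ 'd \<Rightarrow> ('d \<Rightarrow> real) \<Rightarrow> complex ^ 'd"
  where "torus_pt S z t = (\<chi> j. if j \<in> S then of_real (R $ j) * circ (t j) else z $ j)"

definition cauchy_kernel :: "'d set \<Rightarrow> complex ^ 'd \<Rightarrow> ('d \<Rightarrow> real) \<Rightarrow> complex"
  where "cauchy_kernel S z t = (\<Prod>j\<in>S. 1 / (1 - z $ j / (of_real (R $ j) * circ (t j))))"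

lemma measurable_torus_pt [measurable]:
  "torus_pt S z \<in> borel_measurable (Pi\<^sub>M S (\<lambda>_. unit_interval_measure))"
proof -
  have "(\<lambda>t. if j \<in> S then of_real (R $ j) * circ (t j) else z $ j)
      \<in> borel_measurable (Pi\<^sub>M S (\<lambda>_. unit_interval_measure))" for j
    by (cases "j \<in> S") simp_all
  then show ?thesis unfolding torus_pt_def[abs_def] by (rule borel_measurable_vec_lambda)
qed

lemma measurable_cauchy_kernel [measurable]:
  "cauchy_kernel S z \<in> borel_measurable (Pi\<^sub>M S (\<lambda>_. unit_interval_measure))"
  unfolding cauchy_kernel_def[abs_def] by (intro borel_measurable_prod) simp

text \<open>Each induction step applies the one-variable formula in a new coordinate and merges the
  two integrals by Fubini.\<close>

lemma Cauchy_integral_torus: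
  assumes F: "F \<in> entire" and z: "z \<in> polydisc R" and "finite S"
  shows "F z = (\<integral>t. F (torus_pt S z t) * cauchy_kernel S z t \<partial>Pi\<^sub>M S (\<lambda>_. unit_interval_measure))"
  using \<open>finite S\<close>
proof induction
  case empty
  interpret prob_space "Pi\<^sub>M {} (\<lambda>_. unit_interval_measure) :: ('d \<Rightarrow> real) measure"
    by (intro prob_space_PiM prob_space_unit_interval_measure)
  show ?case by (simp add: torus_pt_def cauchy_kernel_def prob_space)
next
  case (insert i S)
  interpret U: prob_space unit_interval_measure by (rule prob_space_unit_interval_measure)
  interpret P: prob_space "Pi\<^sub>M (insert i S) (\<lambda>_. unit_interval_measure)"
    by (intro prob_space_PiM prob_space_unit_interval_measure)
  interpret product_sigma_finite "\<lambda>_::'d. unit_interval_measure" ..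
  have zR: "cmod (z $ j) < R $ j" for j using z by (simp add: polydisc_def)
  have R: "0 < R $ j" for j using zR[of j] by (meson norm_ge_zero order_le_less_trans)
  have [measurable]: "F \<in> borel_measurable borel"
    by (intro borel_measurable_continuous_onI entire_continuous_on F)
  obtain B where B: "\<And>w. \<forall>j. cmod (w $ j) \<le> R $ j \<Longrightarrow> cmod (F w) \<le> B"
    using entire_bounded_on_polydisc[OF F] by blast
  \<comment> \<open>Fubini requires joint integrability. It follows from boundedness: the torus
    points lie in the closed polydisc, where F is bounded, and each kernel factor is bounded because
    |z_j| < R_j.\<close>
  have int: "integrable (Pi\<^sub>M (insert i S) (\<lambda>_. unit_interval_measure))
      (\<lambda>t. F (torus_pt (insert i S) z t) * cauchy_kernel (insert i S) z t)"
  proof (rule P.integrable_const_bound[of _ "B * (\<Prod>j\<in>insert i S. 1 / (1 - cmod (z $ j) / R $ j))"], rule AE_I2)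
    fix t
    have "\<forall>j. cmod (torus_pt (insert i S) z t $ j) \<le> R $ j"
      using zR R by (auto simp: torus_pt_def norm_mult less_imp_le)
    then have "cmod (F (torus_pt (insert i S) z t)) \<le> B" by (rule B)
    moreover have "cmod (cauchy_kernel (insert i S) z t)
        \<le> (\<Prod>j\<in>insert i S. 1 / (1 - cmod (z $ j) / R $ j))"
      unfolding cauchy_kernel_def prod_norm[symmetric]
      by (intro prod_mono conjI geometric_kernel_bound(2) zR norm_ge_zero)
    ultimately show "norm (F (torus_pt (insert i S) z t) * cauchy_kernel (insert i S) z t)
        \<le> B * (\<Prod>j\<in>insert i S. 1 / (1 - cmod (z $ j) / R $ j))"
      unfolding norm_mult by (intro mult_mono) (auto intro: order_trans[OF norm_ge_zero])
  qed simp
  have "F z = (\<integral>t. F (torus_pt S z t) * cauchy_kernel S z t \<partial>Pi\<^sub>M S (\<lambda>_. unit_interval_measure))"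
    by (rule insert.IH)
  also have "\<dots> = (\<integral>t. (\<integral>y. F (torus_pt (insert i S) z (t(i := y))) *
      cauchy_kernel (insert i S) z (t(i := y)) \<partial>unit_interval_measure) \<partial>Pi\<^sub>M S (\<lambda>_. unit_interval_measure))"
  proof (rule Bochner_Integration.integral_cong[OF refl])
    fix t
    let ?f = "\<lambda>u. F (\<chi> k. if k = i then u else torus_pt S z t $ k)"
    let ?k = "\<lambda>y. 1 / (1 - z $ i / (of_real (R $ i) * circ y))"
    \<comment> \<open>As i is not in S, the i-th coordinate of the mixed point is still z_i, so the
      one-variable formula can be applied in that slot.\<close>
    have "(\<chi> k. if k = i then z $ i else torus_pt S z t $ k) = torus_pt S z t"
      using insert.hyps by (auto simp: torus_pt_def vec_eq_iff)
    then have "F (torus_pt S z t) = ?f (z $ i)" by simp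
    also have "\<dots> = (\<integral>y. ?f (of_real (R $ i) * circ y) * ?k y \<partial>unit_interval_measure)"
      by (rule Cauchy_integral_unit_interval[OF entire_holomorphic_coordinate[OF F] zR])
    finally have "F (torus_pt S z t) * cauchy_kernel S z t
        = (\<integral>y. ?f (of_real (R $ i) * circ y) * ?k y * cauchy_kernel S z t \<partial>unit_interval_measure)"
      by (simp only: integral_mult_left_zero)
    also have "\<dots> = (\<integral>y. F (torus_pt (insert i S) z (t(i := y))) *
        cauchy_kernel (insert i S) z (t(i := y)) \<partial>unit_interval_measure)"
    proof (rule Bochner_Integration.integral_cong[OF refl])
      fix y
      have "(\<chi> k. if k = i then of_real (R $ i) * circ y else torus_pt S z t $ k)
          = torus_pt (insert i S) z (t(i := y))"
        by (auto simp: torus_pt_def vec_eq_iff)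
      moreover have "cauchy_kernel (insert i S) z (t(i := y)) = ?k y * cauchy_kernel S z t"
      proof -
        have "(t(i := y)) j = t j" if "j \<in> S" for j using insert.hyps that by auto
        then show ?thesis
          unfolding cauchy_kernel_def prod.insert[OF insert.hyps] fun_upd_same by (simp cong: prod.cong)
      qed
      ultimately show "?f (of_real (R $ i) * circ y) * ?k y * cauchy_kernel S z t =
          F (torus_pt (insert i S) z (t(i := y))) * cauchy_kernel (insert i S) z (t(i := y))"
        by simp
    qed
    finally show "F (torus_pt S z t) * cauchy_kernel S z t = (\<integral>y. F (torus_pt (insert i S) z (t(i := y))) *
        cauchy_kernel (insert i S) z (t(i := y)) \<partial>unit_interval_measure)" .
  qed
  also have "\<dots> = (\<integral>t. F (torus_pt (insert i S) z t) * cauchy_kernel (insert i S) z t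
      \<partial>Pi\<^sub>M (insert i S) (\<lambda>_. unit_interval_measure))"
    by (rule product_integral_insert[symmetric, OF insert.hyps int])
  finally show ?case .
qed

text \<open>The kernel is expanded geometrically in the quotients z_j/w_j and integrated term by
  term. The coefficients are averages of F(w)/w^\<alpha> over the torus, which makes Cauchy's
  estimate immediate; it is stated together with the expansion because the coefficients are given
  only existentially.\<close>

lemma entire_power_series_on_polydisc:
  assumes F: "F \<in> entire" and R: "R \<in> pos_vecs"
  shows "\<exists>a. (\<forall>z\<in>polydisc R. ((\<lambda>\<alpha>. a \<alpha> * mpow z \<alpha>) has_sum F z) UNIV) \<and>
    (\<forall>M. (\<forall>w. (\<forall>j. cmod (w $ j) = R $ j) \<longrightarrow> cmod (F w) \<le> M) \<longrightarrow> (\<forall>\<alpha>. cmod (a \<alpha>) \<le> M / mpow R \<alpha>))"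
proof -
  interpret P: prob_space "Pi\<^sub>M UNIV (\<lambda>_. unit_interval_measure) :: ('d \<Rightarrow> real) measure"
    by (intro prob_space_PiM prob_space_unit_interval_measure)
  let ?\<mu> = "Pi\<^sub>M UNIV (\<lambda>_. unit_interval_measure) :: ('d \<Rightarrow> real) measure"
  have R': "0 < R $ j" for j using R by (simp add: pos_vecs_def)
  have [measurable]: "F \<in> borel_measurable borel"
    by (intro borel_measurable_continuous_onI entire_continuous_on F)
  define w where "w = torus_pt UNIV 0"
  have [measurable]: "w \<in> borel_measurable ?\<mu>" unfolding w_def by (rule measurable_torus_pt)
  have w_norm: "cmod (w t $ j) = R $ j" for t j using R'[of j] by (simp add: w_def torus_pt_def norm_mult)
  have mpow_w: "cmod (mpow (w t) \<alpha>) = mpow R \<alpha>" for t \<alpha>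
    unfolding norm_mpow w_norm by (simp add: mpow_def)
  define a where "a \<alpha> = (\<integral>t. F (w t) / mpow (w t) \<alpha> \<partial>?\<mu>)" for \<alpha>
  obtain B where B: "\<And>w. \<forall>j. cmod (w $ j) \<le> R $ j \<Longrightarrow> cmod (F w) \<le> B"
    using entire_bounded_on_polydisc[OF F] by blast
  have "((\<lambda>\<alpha>. a \<alpha> * mpow z \<alpha>) has_sum F z) UNIV" if z: "z \<in> polydisc R" for z
  proof -
    have zR: "cmod (z $ j) < R $ j" for j using z by (simp add: polydisc_def)
    let ?f = "\<lambda>\<alpha> t. F (w t) * mpow (\<chi> j. z $ j / w t $ j) \<alpha>"
    have "((\<lambda>\<alpha>. \<integral>t. ?f \<alpha> t \<partial>?\<mu>) has_sum (\<integral>t. F (w t) * cauchy_kernel UNIV z t \<partial>?\<mu>)) UNIV"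
    proof (rule has_sum_integral_dominated[where g = "\<lambda>_. 1"])
      have "(\<lambda>\<alpha>. mpow (\<chi> j. cmod (z $ j) / R $ j) \<alpha>) summable_on UNIV"
        by (rule has_sum_imp_summable[OF has_sum_geometric_multiindex])
          (use zR R' in \<open>simp add: abs_of_pos\<close>)
      then show "(\<lambda>\<alpha>. B * mpow (\<chi> j. cmod (z $ j) / R $ j) \<alpha>) summable_on UNIV"
        by (rule summable_on_cmult_right)
      show "AE t in ?\<mu>. 0 \<le> (1::real) \<and> (\<forall>\<alpha>. norm (?f \<alpha> t) \<le> B * mpow (\<chi> j. cmod (z $ j) / R $ j) \<alpha> * 1)
          \<and> ((\<lambda>\<alpha>. ?f \<alpha> t) has_sum F (w t) * cauchy_kernel UNIV z t) UNIV"
      proof (rule AE_I2, intro conjI allI)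
        fix t \<alpha>
        have "cmod (F (w t)) \<le> B" by (rule B) (simp add: w_norm)
        moreover have "cmod (mpow (\<chi> j. z $ j / w t $ j) \<alpha>) = mpow (\<chi> j. cmod (z $ j) / R $ j) \<alpha>"
          by (simp add: norm_mpow norm_divide w_norm)
        moreover have "0 \<le> mpow (\<chi> j. cmod (z $ j) / R $ j) \<alpha>"
          using R' by (simp add: mpow_def prod_nonneg less_imp_le)
        ultimately show "norm (?f \<alpha> t) \<le> B * mpow (\<chi> j. cmod (z $ j) / R $ j) \<alpha> * 1"
          by (simp add: norm_mult mult_right_mono)
      next
        fix t
        have "((\<lambda>\<alpha>. mpow (\<chi> j. z $ j / w t $ j) \<alpha>) has_sum
            (\<Prod>j\<in>UNIV. 1 / (1 - (\<chi> j. z $ j / w t $ j) $ j))) UNIV"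
          by (rule has_sum_geometric_multiindex) (use zR R' in \<open>simp add: norm_divide w_norm\<close>)
        then show "((\<lambda>\<alpha>. ?f \<alpha> t) has_sum F (w t) * cauchy_kernel UNIV z t) UNIV"
          by (intro has_sum_cmult_right) (simp add: cauchy_kernel_def w_def torus_pt_def)
      qed simp
    qed (unfold mpow_divide, measurable)
    moreover have "torus_pt UNIV z = w" by (auto simp: w_def torus_pt_def)
    then have "(\<integral>t. F (w t) * cauchy_kernel UNIV z t \<partial>?\<mu>) = F z"
      using Cauchy_integral_torus[OF F z, of UNIV] by simp
    moreover have "(\<integral>t. ?f \<alpha> t \<partial>?\<mu>) = a \<alpha> * mpow z \<alpha>" for \<alpha>
    proof -
      have "?f \<alpha> t = F (w t) / mpow (w t) \<alpha> * mpow z \<alpha>" for t by (simp add: mpow_divide)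
      then show ?thesis unfolding a_def by (simp only: integral_mult_left_zero)
    qed
    ultimately show ?thesis by simp
  qed
  moreover have "cmod (a \<alpha>) \<le> M / mpow R \<alpha>"
    if M: "\<And>w. \<forall>j. cmod (w $ j) = R $ j \<Longrightarrow> cmod (F w) \<le> M" for M \<alpha>
  proof -
    have le: "cmod (F (w t) / mpow (w t) \<alpha>) \<le> M / mpow R \<alpha>" for t
      using M[of "w t"] mpow_pos[OF R] by (simp add: norm_divide mpow_w w_norm divide_right_mono less_imp_le)
    have "cmod (a \<alpha>) \<le> (\<integral>t. cmod (F (w t) / mpow (w t) \<alpha>) \<partial>?\<mu>)"
      unfolding a_def by (rule integral_norm_bound)
    also have "\<dots> \<le> (\<integral>t. M / mpow R \<alpha> \<partial>?\<mu>)"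
      by (intro integral_mono P.integrable_const integrable_norm le
          P.integrable_const_bound[of _ "M / mpow R \<alpha>"] AE_I2) measurable
    finally show ?thesis by (simp add: P.prob_space)
  qed
  ultimately show ?thesis by blast
qed

end

text \<open>The coefficients obtained for different radii agree by uniqueness on a small common
  polydisc, so one family serves every point and every Cauchy estimate.\<close>

lemma entire_power_series:
  fixes F :: "complex ^ 'd::finite \<Rightarrow> complex"
  assumes F: "F \<in> entire"
  shows "\<exists>a. (\<forall>z. ((\<lambda>\<alpha>. a \<alpha> * mpow z \<alpha>) has_sum F z) UNIV) \<and>
    (\<forall>R\<in>pos_vecs. \<forall>M. (\<forall>w. (\<forall>j. cmod (w $ j) = R $ j) \<longrightarrow> cmod (F w) \<le> M) \<longrightarrow>
      (\<forall>\<alpha>. cmod (a \<alpha>) \<le> M / mpow R \<alpha>))"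
proof -
  let ?P = "\<lambda>R a. (\<forall>z\<in>polydisc R. ((\<lambda>\<alpha>. a \<alpha> * mpow z \<alpha>) has_sum F z) UNIV) \<and>
    (\<forall>M. (\<forall>w. (\<forall>j. cmod (w $ j) = R $ j) \<longrightarrow> cmod (F w) \<le> M) \<longrightarrow>
      (\<forall>\<alpha>. cmod (a \<alpha>) \<le> M / mpow R \<alpha>))"
  have one: "(\<chi> j. (1::real)) \<in> pos_vecs" by (simp add: pos_vecs_def)
  then obtain a where a: "?P (\<chi> j. 1) a" using entire_power_series_on_polydisc[OF F] by blast
  have P: "?P R a" if R: "R \<in> pos_vecs" for R
  proof -
    obtain b where b: "?P R b" using entire_power_series_on_polydisc[OF F R] by blast
    \<comment> \<open>Halving the minimum places the closed polydisc inside both open ones.\<close>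
    let ?r = "\<chi> j. min 1 (R $ j) / 2"
    have r: "?r \<in> pos_vecs" using R by (simp add: pos_vecs_def)
    have lt: "?r $ j < 1" "?r $ j < R $ j" for j
      using R by (auto simp: pos_vecs_def min_def field_simps not_le intro: less_le_trans)
    have "a = b"
    proof (rule power_series_coefficients_unique[OF r])
      fix w :: "complex ^ 'd" assume "\<forall>j. cmod (w $ j) \<le> ?r $ j"
      then have "cmod (w $ j) < 1" "cmod (w $ j) < R $ j" for j
        using lt[of j] by (meson le_less_trans)+
      then have "w \<in> polydisc (\<chi> j. 1)" "w \<in> polydisc R"
        by (auto simp: polydisc_def)
      then show "((\<lambda>\<alpha>. a \<alpha> * mpow w \<alpha>) has_sum F w) UNIV" "((\<lambda>\<alpha>. b \<alpha> * mpow w \<alpha>) has_sum F w) UNIV"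
        using a b by blast+
    qed
    then show ?thesis using b by simp
  qed
  have "((\<lambda>\<alpha>. a \<alpha> * mpow z \<alpha>) has_sum F z) UNIV" for z
  proof -
    have "(\<chi> j. cmod (z $ j) + 1) \<in> pos_vecs" by (simp add: pos_vecs_def add_nonneg_pos)
    moreover have "z \<in> polydisc (\<chi> j. cmod (z $ j) + 1)" by (simp add: polydisc_def)
    ultimately show ?thesis using P by blast
  qed
  then show ?thesis using P by blast
qed

section \<open>Power series define entire functions\<close>

lemma has_derivative_mpow:
  "((\<lambda>z :: complex ^ 'd::finite. mpow z \<alpha>) has_derivative
    (\<lambda>h. \<Sum>i\<in>UNIV. of_nat (\<alpha> i) * (h $ i * z $ i ^ (\<alpha> i - 1)) * (\<Prod>j\<in>UNIV - {i}. z $ j ^ \<alpha> j))) (at z within S)"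
  unfolding mpow_def
  by (rule has_derivative_prod, rule has_derivative_eq_rhs, rule has_derivative_power,
      rule bounded_linear_imp_has_derivative[OF bounded_linear_vec_nth]) (simp add: mult_ac)

text \<open>Differentiation costs a factor |\<alpha>| = \<alpha>_1 + ... + \<alpha>_d, which is at
  most 2^|\<alpha>| and is absorbed by doubling the radius. The assumption \<open>1 \<le> r\<close>
  allows the lowered exponent to be raised again, also when the truncated
  \<open>\<alpha> i - 1\<close> is 0 - 1 = 0.\<close>

lemma norm_derivative_mpow_le:
  fixes z h :: "complex ^ 'd::finite"
  assumes r: "1 \<le> r" and z: "norm z \<le> r"
  shows "cmod (\<Sum>i\<in>UNIV. of_nat (\<alpha> i) * (h $ i * z $ i ^ (\<alpha> i - 1)) * (\<Prod>j\<in>UNIV - {i}. z $ j ^ \<alpha> j))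
    \<le> mpow (\<chi> j. 2 * r) \<alpha> * norm h"
proof -
  have zr: "cmod (z $ j) \<le> r" for j using z Finite_Cartesian_Product.norm_nth_le[of z j] by linarith
  have "cmod (of_nat (\<alpha> i) * (h $ i * z $ i ^ (\<alpha> i - 1)) * (\<Prod>j\<in>UNIV - {i}. z $ j ^ \<alpha> j))
      \<le> real (\<alpha> i) * norm h * mpow (\<chi> j. r) \<alpha>" for i
  proof -
    have "cmod (z $ i) ^ (\<alpha> i - 1) \<le> r ^ (\<alpha> i - 1)" by (intro power_mono zr) simp
    also have "\<dots> \<le> r ^ \<alpha> i" using r by (intro power_increasing) simp_all
    finally have 1: "cmod (z $ i) ^ (\<alpha> i - 1) \<le> r ^ \<alpha> i" .
    have 2: "(\<Prod>j\<in>UNIV - {i}. cmod (z $ j) ^ \<alpha> j) \<le> (\<Prod>j\<in>UNIV - {i}. r ^ \<alpha> j)"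
      by (intro prod_mono conjI power_mono zr) simp_all
    have "(cmod (h $ i) * cmod (z $ i) ^ (\<alpha> i - 1)) * (\<Prod>j\<in>UNIV - {i}. cmod (z $ j) ^ \<alpha> j)
        \<le> (norm h * r ^ \<alpha> i) * (\<Prod>j\<in>UNIV - {i}. r ^ \<alpha> j)"
      using r by (intro mult_mono 1 2 Finite_Cartesian_Product.norm_nth_le) (auto intro!: prod_nonneg)
    also have "\<dots> = norm h * mpow (\<chi> j. r) \<alpha>"
      using prod.remove[of UNIV i "\<lambda>j. r ^ \<alpha> j"] by (simp add: mpow_def)
    finally show ?thesis
      by (simp add: norm_mult norm_power mult_left_mono mult.assoc flip: prod_norm)
  qed
  then have "cmod (\<Sum>i\<in>UNIV. of_nat (\<alpha> i) * (h $ i * z $ i ^ (\<alpha> i - 1)) * (\<Prod>j\<in>UNIV - {i}. z $ j ^ \<alpha> j))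
      \<le> (\<Sum>i\<in>UNIV. real (\<alpha> i) * norm h * mpow (\<chi> j. r) \<alpha>)"
    by (intro sum_norm_le) blast
  also have "\<dots> = real (\<Sum>i\<in>UNIV. \<alpha> i) * (mpow (\<chi> j. r) \<alpha> * norm h)"
    unfolding of_nat_sum sum_distrib_right by (intro sum.cong) (simp_all add: mult_ac)
  also have "\<dots> \<le> 2 ^ (\<Sum>i\<in>UNIV. \<alpha> i) * (mpow (\<chi> j. r) \<alpha> * norm h)"
  proof (rule mult_right_mono)
    show "real (\<Sum>i\<in>UNIV. \<alpha> i) \<le> 2 ^ (\<Sum>i\<in>UNIV. \<alpha> i)"
      by (rule less_imp_le, rule of_nat_less_two_power)
    show "0 \<le> mpow (\<chi> j. r) \<alpha> * norm h" using r by (simp add: mpow_def prod_nonneg)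
  qed
  also have "\<dots> = mpow (\<chi> j. 2 * r) \<alpha> * norm h"
    by (simp add: mpow_def power_mult_distrib prod.distrib power_sum)
  finally show ?thesis .
qed

lemma infinite_UNIV_multiindex: "infinite (UNIV :: ('d \<Rightarrow> nat) set)"
proof
  assume "finite (UNIV :: ('d \<Rightarrow> nat) set)"
  moreover have "inj (\<lambda>n. (\<lambda>_::'d. n :: nat))" by (auto intro: injI dest: fun_cong)
  ultimately show False using finite_imageD[of "\<lambda>n. (\<lambda>_::'d. n :: nat)" UNIV]
    by (meson finite_subset infinite_UNIV_nat subset_UNIV)
qed

text \<open>Termwise differentiation is applied to series over the natural numbers, so the
  multi-indices have to be enumerated; unconditional convergence makes the order immaterial.\<close>

lemma has_sum_imp_sums_from_nat_into:
  fixes f :: "'i \<Rightarrow> 'b::real_normed_vector"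
  assumes "(f has_sum s) UNIV" "countable (UNIV :: 'i set)" "infinite (UNIV :: 'i set)"
  shows "(\<lambda>n. f (from_nat_into UNIV n)) sums s"
proof -
  have "bij_betw (from_nat_into UNIV) UNIV (UNIV :: 'i set)"
    using assms by (intro bij_betw_from_nat_into)
  from has_sum_reindex_bij_betw[OF this, of f s] show ?thesis
    using assms(1) by (intro has_sum_imp_sums) simp
qed

text \<open>The series is differentiated term by term on a ball around the origin that contains z.
  The derivatives there are dominated by the terms of the original series at a point with all
  coordinates \<open>2 * r\<close>.\<close>

lemma power_series_entire:
  fixes F :: "complex ^ 'd::finite \<Rightarrow> complex"
  assumes F: "\<And>z. ((\<lambda>\<alpha>. a \<alpha> * mpow z \<alpha>) has_sum F z) UNIV"
  shows "F \<in> entire"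
  unfolding entire_def
proof (intro CollectI allI)
  fix z :: "complex ^ 'd"
  \<comment> \<open>Makes z an interior point of the ball and ensures \<open>1 \<le> r\<close>, as
    the derivative estimate demands.\<close>
  define r where "r = norm z + 1"
  define e :: "nat \<Rightarrow> 'd \<Rightarrow> nat" where "e = from_nat_into UNIV"
  have sums: "(\<lambda>n. f (e n)) sums s" if "(f has_sum s) UNIV" for f :: "('d \<Rightarrow> nat) \<Rightarrow> 'b::real_normed_vector" and s
    unfolding e_def by (rule has_sum_imp_sums_from_nat_into[OF that]) (simp_all add: infinite_UNIV_multiindex)
  define D where "D \<alpha> z h = (\<Sum>i\<in>UNIV. of_nat (\<alpha> i) * (h $ i * z $ i ^ (\<alpha> i - 1)) * (\<Prod>j\<in>UNIV - {i}. z $ j ^ \<alpha> j))"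
    for \<alpha> and z h :: "complex ^ 'd"
  define f' where "f' n z h = a (e n) * D (e n) z h" for n z h
  define g' where "g' z h = (\<Sum>n. f' n z h)" for z h
  define M where "M n = cmod (a (e n)) * mpow (\<chi> j. 2 * r) (e n)" for n
  \<comment> \<open>Convergence at the diagonal point is absolute, and this is the summability of
    the majorant \<open>M\<close>.\<close>
  have "(\<lambda>\<alpha>. a \<alpha> * mpow (\<chi> j. complex_of_real ((\<chi> j. 2 * r) $ j)) \<alpha>) summable_on UNIV"
    using F by (rule has_sum_imp_summable)
  then have "(\<lambda>\<alpha>. cmod (a \<alpha> * mpow (\<chi> j. complex_of_real ((\<chi> j. 2 * r) $ j)) \<alpha>)) summable_on UNIV"
    by (simp only: summable_on_iff_abs_summable_on_complex)
  moreover have "0 \<le> mpow (\<chi> j. 2 * r) \<alpha>" for \<alpha> :: "'d \<Rightarrow> nat"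
    by (simp add: mpow_def prod_nonneg r_def)
  ultimately have "(\<lambda>\<alpha>. cmod (a \<alpha>) * mpow (\<chi> j. 2 * r) \<alpha>) summable_on UNIV"
    unfolding mpow_of_real norm_mult norm_of_real by (simp only: abs_of_nonneg)
  then have M: "summable M"
    unfolding M_def by (rule sums_summable[OF sums[OF has_sum_infsum]])
  have bound: "cmod (f' n x h) \<le> M n * norm h" if "norm x < r" for n x h
    using norm_derivative_mpow_le[of r x "e n" h] that
    by (simp add: f'_def D_def M_def norm_mult mult.assoc mult_left_mono r_def)
  have summable_f': "summable (\<lambda>n. f' n x h)" if "norm x < r" for x h
    using bound[OF that] by (intro summable_comparison_test'[OF summable_mult2[OF M, of "norm h"]]) auto
  have "\<exists>g. \<forall>x\<in>ball 0 r. (\<lambda>n. a (e n) * mpow x (e n)) sums g x \<and> (g has_derivative g' x) (at x within ball 0 r)"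
  proof (rule has_derivative_series[where x = z and f' = f'])
    show "((\<lambda>x. a (e n) * mpow x (e n)) has_derivative f' n x) (at x within ball 0 r)" for n x
      unfolding f'_def D_def by (intro has_derivative_mult_right has_derivative_mpow)
    show "\<forall>\<^sub>F n in sequentially. \<forall>x\<in>ball 0 r. \<forall>h. norm ((\<Sum>i<n. f' i x h) - g' x h) \<le> \<epsilon> * norm h"
      if "\<epsilon> > 0" for \<epsilon>
    proof -
      have "(\<lambda>n. suminf M - (\<Sum>i<n. M i)) \<longlonglongrightarrow> suminf M - suminf M"
        by (intro tendsto_intros summable_LIMSEQ M)
      then have "\<forall>\<^sub>F n in sequentially. suminf M - (\<Sum>i<n. M i) < \<epsilon>"
        using \<open>\<epsilon> > 0\<close> by (simp add: order_tendsto_iff)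
      then show ?thesis
      proof eventually_elim
        case (elim n)
        show ?case
        proof (intro ballI allI)
          fix x h :: "complex ^ 'd" assume "x \<in> ball 0 r"
          then have x: "norm x < r" by simp
          have "g' x h - (\<Sum>i<n. f' i x h) = (\<Sum>i. f' (i + n) x h)"
            unfolding g'_def using suminf_minus_initial_segment[OF summable_f'[OF x]] by simp
          also have "norm \<dots> \<le> (\<Sum>i. M (i + n) * norm h)"
            using bound[OF x] by (intro norm_suminf_le summable_mult2 summable_ignore_initial_segment M)
          also have "\<dots> = (suminf M - (\<Sum>i<n. M i)) * norm h"
            using suminf_mult2[OF summable_ignore_initial_segment[OF M, of n], of "norm h"]
              suminf_minus_initial_segment[OF M, of n] by simp
          also have "\<dots> \<le> \<epsilon> * norm h" using elim by (intro mult_right_mono) auto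
          finally show "norm ((\<Sum>i<n. f' i x h) - g' x h) \<le> \<epsilon> * norm h" by (simp add: norm_minus_commute)
        qed
      qed
    qed
    show "(\<lambda>n. a (e n) * mpow z (e n)) sums F z" by (rule sums[OF F])
  qed (simp_all add: r_def)
  then obtain g where g: "\<And>x. x \<in> ball 0 r \<Longrightarrow> (\<lambda>n. a (e n) * mpow x (e n)) sums g x"
    "\<And>x. x \<in> ball 0 r \<Longrightarrow> (g has_derivative g' x) (at x within ball 0 r)" by blast
  have z: "z \<in> ball 0 r" by (simp add: r_def)
  have "g x = F x" if "x \<in> ball 0 r" for x
    using g(1)[OF that] sums[OF F[of x]] by (rule sums_unique2)
  moreover have "(g has_derivative g' z) (at z)"
    using g(2)[OF z] unfolding at_within_open[OF z open_ball] .
  ultimately have "(F has_derivative g' z) (at z)"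
    using has_derivative_transform_within_open[OF _ open_ball z, of g "g' z" UNIV F] by blast
  \<comment> \<open>The termwise derivatives are complex linear, and homogeneity passes to their
    convergent sum.\<close>
  moreover have "g' z (c *s v) = c * g' z v" for c v
  proof -
    have "D \<alpha> z (c *s v) = c * D \<alpha> z v" for \<alpha>
      unfolding D_def sum_distrib_left by (intro sum.cong) (simp_all add: mult_ac)
    then have "f' n z (c *s v) = c * f' n z v" for n by (simp add: f'_def)
    then show ?thesis
      unfolding g'_def using z by (simp add: suminf_mult summable_f')
  qed
  ultimately show "\<exists>F'. (F has_derivative F') (at z) \<and> (\<forall>a v. F' (a *s v) = a * F' v)" by blast
qed

section \<open>Taylor coefficients and the space \<open>A0_flat1\<close>\<close>

text \<open>The factor turns coefficients in the normalised basis into those of z^\<alpha>, on which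
  the operator acts most simply and in which the two spaces differ by the factor \<alpha>!
  alone.\<close>

definition taylor :: "(complex ^ 'd::finite \<Rightarrow> complex) \<Rightarrow> ('d \<Rightarrow> nat) \<Rightarrow> complex"
  where "taylor F \<alpha> = coef F \<alpha> / of_real (sqrt (mfact \<alpha>))"

text \<open>Uniqueness of coefficients is what allows the definite description in
  \<open>coef\<close> to be evaluated.\<close>

lemma taylor_eqI:
  fixes F :: "complex ^ 'd::finite \<Rightarrow> complex"
  assumes F: "\<And>z. ((\<lambda>\<alpha>. a \<alpha> * mpow z \<alpha>) has_sum F z) UNIV"
  shows "taylor F = a"
proof -
  have "coef F = (\<lambda>\<alpha>. a \<alpha> * of_real (sqrt (mfact \<alpha>)))"
    unfolding coef_def
  proof (rule the_equality)
    show "\<forall>z. ((\<lambda>\<alpha>. a \<alpha> * of_real (sqrt (mfact \<alpha>)) * e_basis \<alpha> z) has_sum F z) UNIV"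
      using F by (simp add: e_basis_def)
  next
    fix c assume c: "\<forall>z. ((\<lambda>\<alpha>. c \<alpha> * e_basis \<alpha> z) has_sum F z) UNIV"
    have "(\<lambda>\<alpha>. c \<alpha> / of_real (sqrt (mfact \<alpha>))) = a"
    proof (rule power_series_coefficients_unique[where R = "\<chi> j. 1"])
      show "((\<lambda>\<alpha>. c \<alpha> / of_real (sqrt (mfact \<alpha>)) * mpow w \<alpha>) has_sum F w) UNIV" for w
        using c[rule_format, of w] by (simp add: e_basis_def)
    qed (use F in \<open>auto simp: pos_vecs_def\<close>)
    then show "c = (\<lambda>\<alpha>. a \<alpha> * of_real (sqrt (mfact \<alpha>)))" by (auto simp: fun_eq_iff divide_eq_eq)
  qed
  then show ?thesis by (simp add: taylor_def fun_eq_iff)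
qed

lemma
  assumes F: "F \<in> entire"
  shows has_sum_taylor: "((\<lambda>\<alpha>. taylor F \<alpha> * mpow z \<alpha>) has_sum F z) UNIV"
    and Cauchy_estimate: "R \<in> pos_vecs \<Longrightarrow> (\<And>w. \<forall>j. cmod (w $ j) = R $ j \<Longrightarrow> cmod (F w) \<le> M) \<Longrightarrow>
      cmod (taylor F \<alpha>) \<le> M / mpow R \<alpha>"
proof -
  obtain a where a: "\<forall>z. ((\<lambda>\<alpha>. a \<alpha> * mpow z \<alpha>) has_sum F z) UNIV"
    "\<forall>R\<in>pos_vecs. \<forall>M. (\<forall>w. (\<forall>j. cmod (w $ j) = R $ j) \<longrightarrow> cmod (F w) \<le> M) \<longrightarrow>
      (\<forall>\<alpha>. cmod (a \<alpha>) \<le> M / mpow R \<alpha>)"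
    using entire_power_series[OF F] by blast
  have "taylor F = a" using a(1) by (intro taylor_eqI) blast
  then show "((\<lambda>\<alpha>. taylor F \<alpha> * mpow z \<alpha>) has_sum F z) UNIV"
    and "R \<in> pos_vecs \<Longrightarrow> (\<And>w. \<forall>j. cmod (w $ j) = R $ j \<Longrightarrow> cmod (F w) \<le> M) \<Longrightarrow>
      cmod (taylor F \<alpha>) \<le> M / mpow R \<alpha>"
    using a by blast+
qed

lemma entire_eqI:
  assumes "F \<in> entire" "G \<in> entire" "taylor F = taylor G"
  shows "F = G"
proof
  fix z
  show "F z = G z"
    using has_sum_taylor[OF assms(1), of z] has_sum_taylor[OF assms(2), of z] assms(3)
    by (simp add: has_sum_unique)
qed

text \<open>This is Cauchy's estimate on the torus with the reciprocal radii 1/r_j.\<close>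

lemma taylor_bounded:
  fixes F :: "complex ^ 'd::finite \<Rightarrow> complex"
  assumes "F \<in> entire" "r \<in> pos_vecs"
  shows "\<exists>C>0. \<forall>\<alpha>. cmod (taylor F \<alpha>) \<le> C * mpow r \<alpha>"
proof -
  define R where "R = (\<chi> j. 1 / r $ j)"
  have R: "R \<in> pos_vecs" using assms(2) by (simp add: R_def pos_vecs_def)
  obtain B where B: "\<And>w. \<forall>j. cmod (w $ j) \<le> R $ j \<Longrightarrow> cmod (F w) \<le> B"
    using entire_bounded_on_polydisc[OF assms(1)] by blast
  have "cmod (taylor F \<alpha>) \<le> (\<bar>B\<bar> + 1) * mpow r \<alpha>" for \<alpha>
  proof -
    have "cmod (taylor F \<alpha>) \<le> (\<bar>B\<bar> + 1) / mpow R \<alpha>"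
    proof (rule Cauchy_estimate[OF assms(1) R])
      fix w :: "complex ^ 'd" assume "\<forall>j. cmod (w $ j) = R $ j"
      then show "cmod (F w) \<le> \<bar>B\<bar> + 1" using B[of w] by simp
    qed
    moreover have "mpow R \<alpha> = 1 / mpow r \<alpha>"
      unfolding R_def by (simp add: mpow_def power_one_over prod_dividef)
    ultimately show ?thesis by simp
  qed
  then show ?thesis by (intro exI[of _ "\<bar>B\<bar> + 1"]) auto
qed

text \<open>Coefficients smaller than every geometric sequence give a series that a geometric series
  dominates at each point; its sum is entire.\<close>

lemma entire_with_taylor:
  fixes a :: "('d::finite \<Rightarrow> nat) \<Rightarrow> complex"
  assumes a: "\<And>r. r \<in> pos_vecs \<Longrightarrow> \<exists>C. \<forall>\<alpha>. cmod (a \<alpha>) \<le> C * mpow r \<alpha>"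
  shows "\<exists>F\<in>entire. taylor F = a"
proof -
  have "\<exists>s. ((\<lambda>\<alpha>. a \<alpha> * mpow z \<alpha>) has_sum s) UNIV" for z
  proof -
    \<comment> \<open>The radii depend on z so that r_j |z_j| \<le> 1/2; adding 1 keeps them defined
      where z_j = 0.\<close>
    define r where "r = (\<chi> j. 1 / (2 * (cmod (z $ j) + 1)))"
    have r: "0 < r $ j" for j by (simp add: r_def add_nonneg_pos)
    then obtain C where C: "cmod (a \<alpha>) \<le> C * mpow r \<alpha>" for \<alpha>
      using a[of r] by (auto simp: pos_vecs_def)
    have C0: "0 \<le> C" using order_trans[OF norm_ge_zero C[of "\<lambda>_. 0"]] by (simp add: mpow_def)
    have rz: "r $ j * cmod (z $ j) \<le> 1/2" for j
      by (simp add: r_def divide_simps add_nonneg_pos)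
    have "(\<lambda>\<alpha>. mpow (\<chi> j. (1/2::real)) \<alpha>) summable_on (UNIV :: ('d \<Rightarrow> nat) set)"
      by (rule has_sum_imp_summable[OF has_sum_geometric_multiindex]) simp
    then have "(\<lambda>\<alpha>. C * mpow (\<chi> j. (1/2::real)) \<alpha>) summable_on (UNIV :: ('d \<Rightarrow> nat) set)"
      by (rule summable_on_cmult_right)
    then have "(\<lambda>\<alpha>. cmod (a \<alpha> * mpow z \<alpha>)) summable_on UNIV"
    proof (rule Infinite_Sum.abs_summable_on_comparison_test')
      fix \<alpha>
      have "cmod (a \<alpha> * mpow z \<alpha>) \<le> C * mpow r \<alpha> * mpow (\<chi> j. cmod (z $ j)) \<alpha>"
        unfolding norm_mult norm_mpow
        by (intro mult_right_mono C) (simp add: mpow_def prod_nonneg)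
      also have "\<dots> = C * mpow (\<chi> j. r $ j * cmod (z $ j)) \<alpha>"
        using mpow_mult[of r "\<chi> j. cmod (z $ j)" \<alpha>] by simp
      also have "\<dots> \<le> C * mpow (\<chi> j. (1/2::real)) \<alpha>"
        using r rz C0 by (intro mult_left_mono mpow_mono) (auto simp: less_imp_le)
      finally show "cmod (a \<alpha> * mpow z \<alpha>) \<le> C * mpow (\<chi> j. (1/2::real)) \<alpha>" .
    qed
    then have "(\<lambda>\<alpha>. a \<alpha> * mpow z \<alpha>) summable_on UNIV" by (rule abs_summable_summable)
    then show ?thesis unfolding summable_on_def .
  qed
  then obtain F where F: "((\<lambda>\<alpha>. a \<alpha> * mpow z \<alpha>) has_sum F z) UNIV" for z by metis
  show ?thesis using power_series_entire[OF F] taylor_eqI[OF F] by blast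
qed

lemma norm_coef: "cmod (coef F \<alpha>) = cmod (taylor F \<alpha>) * sqrt (mfact \<alpha>)"
  by (simp add: taylor_def norm_divide less_imp_le)

lemma A0_flat1_iff:
  "F \<in> A0_flat1 \<longleftrightarrow> F \<in> entire \<and> (\<forall>r\<in>pos_vecs. \<exists>C>0. \<forall>\<alpha>. cmod (taylor F \<alpha>) \<le> C * (mpow r \<alpha> / mfact \<alpha>))"
proof -
  have "cmod (coef F \<alpha>) \<le> C * (mpow r \<alpha> / sqrt (mfact \<alpha>)) \<longleftrightarrow> cmod (taylor F \<alpha>) \<le> C * (mpow r \<alpha> / mfact \<alpha>)"
    for C r \<alpha>
  proof -
    have "C * (mpow r \<alpha> / sqrt (mfact \<alpha>)) = C * (mpow r \<alpha> / mfact \<alpha>) * sqrt (mfact \<alpha>)"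
      by (simp add: divide_simps)
    then show ?thesis
      unfolding norm_coef by (simp only: mult_le_cancel_right_pos real_sqrt_gt_zero mfact_pos)
  qed
  then show ?thesis by (simp add: A0_flat1_def)
qed

lemma A0_flat1_norm_eq: "A0_flat1_norm r F = (SUP \<alpha>. cmod (taylor F \<alpha>) * mfact \<alpha> / mpow r \<alpha>)"
  by (simp add: A0_flat1_norm_def norm_coef mult.assoc)

lemma entire_norm_eq: "entire_norm r F = (SUP \<alpha>. cmod (taylor F \<alpha>) / mpow r \<alpha>)"
  by (simp add: entire_norm_def norm_coef)

lemma entire_diff:
  assumes "F \<in> entire" "G \<in> entire"
  shows "(\<lambda>z. F z - G z) \<in> entire" and "taylor (\<lambda>z. F z - G z) \<alpha> = taylor F \<alpha> - taylor G \<alpha>"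
proof -
  have "((\<lambda>\<alpha>. (taylor F \<alpha> - taylor G \<alpha>) * mpow z \<alpha>) has_sum (F z - G z)) UNIV" for z
    using has_sum_add[OF has_sum_taylor[OF assms(1)] has_sum_uminusI[OF has_sum_taylor[OF assms(2)]], of z z]
    by (simp add: left_diff_distrib)
  then show "(\<lambda>z. F z - G z) \<in> entire" "taylor (\<lambda>z. F z - G z) \<alpha> = taylor F \<alpha> - taylor G \<alpha>"
    using power_series_entire[of "\<lambda>\<alpha>. taylor F \<alpha> - taylor G \<alpha>" "\<lambda>z. F z - G z"]
      taylor_eqI[of "\<lambda>\<alpha>. taylor F \<alpha> - taylor G \<alpha>" "\<lambda>z. F z - G z"] by auto
qed

text \<open>In one direction the bounds on the terms add up to an exponential series. In the other,
  Cauchy's estimate is optimised over the radii separately for each \<alpha>, and n! \<le> n^n turns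
  the outcome into a factorial bound.\<close>

lemma A0_flat1_iff_growth:
  fixes F :: "complex ^ 'd::finite \<Rightarrow> complex"
  assumes F: "F \<in> entire"
  shows "F \<in> A0_flat1 \<longleftrightarrow>
    (\<forall>r\<in>pos_vecs. \<exists>C>0. \<forall>z. cmod (F z) \<le> C * exp (\<Sum>j\<in>UNIV. r $ j * cmod (z $ j)))"
proof
  assume A: "F \<in> A0_flat1"
  show "\<forall>r\<in>pos_vecs. \<exists>C>0. \<forall>z. cmod (F z) \<le> C * exp (\<Sum>j\<in>UNIV. r $ j * cmod (z $ j))"
  proof
    fix r :: "real ^ 'd" assume "r \<in> pos_vecs"
    then obtain C where C: "C > 0" "\<And>\<alpha>. cmod (taylor F \<alpha>) \<le> C * (mpow r \<alpha> / mfact \<alpha>)"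
      using A by (auto simp: A0_flat1_iff)
    have "cmod (F z) \<le> C * exp (\<Sum>j\<in>UNIV. r $ j * cmod (z $ j))" for z
    proof (rule norm_infsum_le[OF has_sum_taylor[OF F]])
      show "((\<lambda>\<alpha>. C * (mpow (\<chi> j. r $ j * cmod (z $ j)) \<alpha> / mfact \<alpha>)) has_sum
          C * exp (\<Sum>j\<in>UNIV. r $ j * cmod (z $ j))) UNIV"
        using has_sum_cmult_right[OF has_sum_exp_multiindex[of "\<chi> j. r $ j * cmod (z $ j)"], of C] by simp
      show "cmod (taylor F \<alpha> * mpow z \<alpha>) \<le> C * (mpow (\<chi> j. r $ j * cmod (z $ j)) \<alpha> / mfact \<alpha>)" for \<alpha>
      proof -
        have "cmod (taylor F \<alpha>) * mpow (\<chi> j. cmod (z $ j)) \<alpha> \<le> C * (mpow r \<alpha> / mfact \<alpha>) * mpow (\<chi> j. cmod (z $ j)) \<alpha>"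
          by (intro mult_right_mono C) (simp add: mpow_def prod_nonneg)
        then show ?thesis
          using mpow_mult[of r "\<chi> j. cmod (z $ j)" \<alpha>] by (simp add: norm_mult norm_mpow)
      qed
    qed
    then show "\<exists>C>0. \<forall>z. cmod (F z) \<le> C * exp (\<Sum>j\<in>UNIV. r $ j * cmod (z $ j))" using C(1) by blast
  qed
next
  assume G: "\<forall>r\<in>pos_vecs. \<exists>C>0. \<forall>z. cmod (F z) \<le> C * exp (\<Sum>j\<in>UNIV. r $ j * cmod (z $ j))"
  have exp_real: "exp (real n) = exp 1 ^ n" for n
    using exp_of_nat_mult[of n "1::real"] by simp
  have "\<exists>C>0. \<forall>\<alpha>. cmod (taylor F \<alpha>) \<le> C * (mpow r \<alpha> / mfact \<alpha>)" if r: "r \<in> pos_vecs" for r :: "real ^ 'd"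
  proof -
    \<comment> \<open>The optimal radii produce a factor exp(\<alpha>_j) in each coordinate;
      dividing r by e beforehand compensates for it.\<close>
    define s where "s = (\<chi> j. r $ j / exp 1)"
    have s: "0 < s $ j" for j using r by (simp add: s_def pos_vecs_def)
    then have "s \<in> pos_vecs" by (simp add: pos_vecs_def)
    with G obtain C where C: "C > 0" "\<And>z. cmod (F z) \<le> C * exp (\<Sum>j\<in>UNIV. s $ j * cmod (z $ j))"
      by blast
    have "cmod (taylor F \<alpha>) \<le> C * exp (real CARD('d)) * (mpow r \<alpha> / mfact \<alpha>)" for \<alpha>
    proof -
      \<comment> \<open>\<open>R\<close> minimises \<open>exp (s R) / R ^ \<alpha>\<close> in every coordinate with \<open>\<alpha> j > 0\<close>.\<close>
      define R where "R = (\<chi> j. real (max (\<alpha> j) 1) / s $ j)"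
      have R: "R \<in> pos_vecs" using s by (simp add: R_def pos_vecs_def)
      have "cmod (taylor F \<alpha>) \<le> C * exp (\<Sum>j\<in>UNIV. s $ j * R $ j) / mpow R \<alpha>"
      proof (rule Cauchy_estimate[OF F R])
        fix w :: "complex ^ 'd" assume "\<forall>j. cmod (w $ j) = R $ j"
        then show "cmod (F w) \<le> C * exp (\<Sum>j\<in>UNIV. s $ j * R $ j)" using C(2)[of w] by simp
      qed
      also have "C * exp (\<Sum>j\<in>UNIV. s $ j * R $ j) / mpow R \<alpha>
          = C * (\<Prod>j\<in>UNIV. exp (s $ j * R $ j) / (R $ j) ^ \<alpha> j)"
        by (simp add: exp_sum mpow_def prod_dividef)
      also have "\<dots> \<le> C * (\<Prod>j\<in>UNIV. exp 1 * ((r $ j) ^ \<alpha> j / fact (\<alpha> j)))"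
      proof (intro mult_left_mono prod_mono conjI)
        fix j
        show "0 \<le> exp (s $ j * R $ j) / (R $ j) ^ \<alpha> j" using R by (simp add: pos_vecs_def less_imp_le)
        let ?m = "real (max (\<alpha> j) 1)"
        \<comment> \<open>Here s_j R_j is \<open>max (\<alpha> j) 1\<close>, which is at most
          \<alpha>_j + 1. The spare factor e covers \<alpha>_j = 0, and over all coordinates these
          factors form \<open>exp (real CARD('d))\<close>.\<close>
        have "exp (s $ j * R $ j) \<le> exp (1 + real (\<alpha> j))" using s[of j] by (simp add: R_def max_def)
        also have "\<dots> = exp 1 * exp 1 ^ \<alpha> j"
          by (simp only: exp_add exp_real)
        finally have 1: "exp (s $ j * R $ j) \<le> exp 1 * exp 1 ^ \<alpha> j" .
        have "fact (\<alpha> j) \<le> real (\<alpha> j ^ \<alpha> j)" by (rule fact_le_power)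
        also have "\<dots> \<le> ?m ^ \<alpha> j" unfolding of_nat_power by (intro power_mono) auto
        finally have 2: "fact (\<alpha> j) \<le> ?m ^ \<alpha> j" .
        have "(R $ j) ^ \<alpha> j = ?m ^ \<alpha> j / (s $ j) ^ \<alpha> j" by (simp add: R_def power_divide)
        then have "exp (s $ j * R $ j) / (R $ j) ^ \<alpha> j = exp (s $ j * R $ j) * (s $ j) ^ \<alpha> j / ?m ^ \<alpha> j" by simp
        also have "\<dots> \<le> exp 1 * exp 1 ^ \<alpha> j * (s $ j) ^ \<alpha> j / fact (\<alpha> j)"
          using s[of j] by (intro frac_le mult_right_mono 1 2) (simp_all add: less_imp_le)
        also have "\<dots> = exp 1 * ((r $ j) ^ \<alpha> j / fact (\<alpha> j))"
          by (simp add: s_def power_divide)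
        finally show "exp (s $ j * R $ j) / (R $ j) ^ \<alpha> j \<le> exp 1 * ((r $ j) ^ \<alpha> j / fact (\<alpha> j))" .
      qed (use C(1) in simp)
      also have "\<dots> = C * exp (real CARD('d)) * (mpow r \<alpha> / mfact \<alpha>)"
        unfolding exp_real mpow_def mfact_def by (simp add: prod.distrib prod_dividef)
      finally show ?thesis .
    qed
    then show ?thesis using C(1) by (intro exI[of _ "C * exp (real CARD('d))"]) auto
  qed
  then show "F \<in> A0_flat1" using F by (simp add: A0_flat1_iff)
qed

section \<open>The weighted projection\<close>

context reinhardt_weight
begin

definition proj :: "(complex ^ 'd \<Rightarrow> complex) \<Rightarrow> complex ^ 'd \<Rightarrow> complex"
  where "proj F z = (\<integral>w. g w *\<^sub>R (F w * exp (herm z w)) \<partial>lborel)"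

lemma has_sum_exp_herm:
  "((\<lambda>\<beta>. mpow z \<beta> * cnj (mpow w \<beta>) / of_real (mfact \<beta>)) has_sum exp (herm z w)) UNIV"
  for z w :: "complex ^ 'd"
  using has_sum_exp_multiindex[of "\<chi> j. z $ j * cnj (w $ j)"]
    mpow_mult[of z "\<chi> j. cnj (w $ j)"] by (simp add: herm_def mpow_cnj)

text \<open>Only the kernel is expanded here, with F merely bounded on the support; the Taylor
  series of F enters afterwards, in evaluating each integral. Two single expansions thus replace a
  double series.\<close>

lemma has_sum_proj:
  assumes F: "F \<in> entire"
  shows "((\<lambda>\<beta>. taylor F \<beta> * of_real (moment \<beta> / mfact \<beta>) * mpow z \<beta>) has_sum proj F z) UNIV"
proof -
  have [measurable]: "F \<in> borel_measurable borel"
    by (intro borel_measurable_continuous_onI entire_continuous_on F)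
  have [measurable]: "(\<lambda>w. exp (herm z w)) \<in> borel_measurable borel"
    unfolding herm_def by (intro borel_measurable_continuous_onI continuous_intros)
  obtain B where B: "\<And>w. \<forall>j. cmod (w $ j) \<le> R $ j \<Longrightarrow> cmod (F w) \<le> B"
    using entire_bounded_on_polydisc[OF F] by blast
  let ?f = "\<lambda>\<beta> w. g w *\<^sub>R (F w * (mpow z \<beta> * cnj (mpow w \<beta>) / of_real (mfact \<beta>)))"
  let ?M = "\<lambda>\<beta>. B * (mpow (\<chi> j. cmod (z $ j) * R $ j) \<beta> / mfact \<beta>)"
  have "((\<lambda>\<beta>. \<integral>w. ?f \<beta> w \<partial>lborel) has_sum proj F z) UNIV"
    unfolding proj_def
  proof (rule has_sum_integral_dominated[OF _ integrable_weight])
    show "?M summable_on UNIV"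
      using has_sum_imp_summable[OF has_sum_exp_multiindex[of "\<chi> j. cmod (z $ j) * R $ j"]]
      by (intro summable_on_cmult_right) simp
    show "AE w in lborel. 0 \<le> g w \<and> (\<forall>\<beta>. norm (?f \<beta> w) \<le> ?M \<beta> * g w) \<and>
        ((\<lambda>\<beta>. ?f \<beta> w) has_sum g w *\<^sub>R (F w * exp (herm z w))) UNIV"
      using weight_nonneg weight_support
    proof eventually_elim
      case (elim w)
      have "norm (?f \<beta> w) \<le> ?M \<beta> * g w" for \<beta>
      proof (cases "g w = 0")
        case False
        then have w: "\<forall>j. cmod (w $ j) \<le> R $ j" using elim by blast
        have B0: "0 \<le> B" using B[OF w] by (rule order_trans[OF norm_ge_zero])
        have "0 \<le> mpow (\<chi> j. cmod (z $ j)) \<beta>" by (simp add: mpow_def prod_nonneg)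
        then have "cmod (F w) * (mpow (\<chi> j. cmod (z $ j)) \<beta> * cmod (mpow w \<beta>))
            \<le> B * (mpow (\<chi> j. cmod (z $ j)) \<beta> * mpow R \<beta>)"
          using B0 by (intro mult_mono mult_left_mono norm_mpow_le B w) auto
        also have "\<dots> = B * mpow (\<chi> j. cmod (z $ j) * R $ j) \<beta>"
          using mpow_mult[of "\<chi> j. cmod (z $ j)" R \<beta>] by simp
        finally have "g w / mfact \<beta> * (cmod (F w) * (mpow (\<chi> j. cmod (z $ j)) \<beta> * cmod (mpow w \<beta>)))
            \<le> g w / mfact \<beta> * (B * mpow (\<chi> j. cmod (z $ j) * R $ j) \<beta>)"
          using elim(1) by (intro mult_left_mono) auto
        then show ?thesis
          using elim(1) by (simp add: norm_mult norm_divide norm_mpow[of z] mult_ac)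
      qed simp
      moreover have "((\<lambda>\<beta>. ?f \<beta> w) has_sum g w *\<^sub>R (F w * exp (herm z w))) UNIV"
        unfolding scaleR_conv_of_real by (intro has_sum_cmult_right has_sum_exp_herm)
      ultimately show ?case using elim(1) by blast
    qed
  qed simp_all
  moreover have "(\<integral>w. ?f \<beta> w \<partial>lborel) = taylor F \<beta> * of_real (moment \<beta> / mfact \<beta>) * mpow z \<beta>" for \<beta>
  proof -
    have "(\<integral>w. ?f \<beta> w \<partial>lborel)
        = (\<integral>w. mpow z \<beta> / of_real (mfact \<beta>) * (g w *\<^sub>R (F w * cnj (mpow w \<beta>))) \<partial>lborel)"
      by (simp add: mult_ac)
    also have "\<dots> = mpow z \<beta> / of_real (mfact \<beta>) * (taylor F \<beta> * of_real (moment \<beta>))"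
      by (subst integral_mult_right_zero, subst integral_weight_power_series[OF _ has_sum_taylor[OF F]]) simp_all
    finally show ?thesis by simp
  qed
  ultimately show ?thesis by simp
qed

lemma
  assumes "F \<in> entire"
  shows proj_entire: "proj F \<in> entire"
    and taylor_proj: "taylor (proj F) \<beta> = taylor F \<beta> * of_real (moment \<beta> / mfact \<beta>)"
  using power_series_entire[OF has_sum_proj[OF assms]] taylor_eqI[OF has_sum_proj[OF assms]] by simp_all

text \<open>Linearity is read off from the diagonal action on coefficients. It reduces the
  continuity estimates for differences to bounds for a single function.\<close>

lemma proj_diff:
  assumes "F \<in> entire" "G \<in> entire"
  shows "proj (\<lambda>z. F z - G z) = (\<lambda>z. proj F z - proj G z)"
  by (rule entire_eqI)
    (auto simp: entire_diff proj_entire taylor_proj assms fun_eq_iff left_diff_distrib diff_divide_distrib)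

lemma moment_nonneg: "0 \<le> moment \<beta>"
  unfolding moment_def
  by (rule integral_nonneg_AE) (use weight_nonneg in eventually_elim, simp)

lemma weight_integral_nonneg: "0 \<le> (\<integral>w. g w \<partial>lborel)"
  by (rule integral_nonneg_AE) (rule weight_nonneg)

text \<open>The factorials cancel, and R^(2\<beta>) from the moment bound is absorbed by replacing
  the radii r with r/R^2. Adding 1 to the mass of g, known here only to be nonnegative, makes the
  constant positive, as the continuity criterion requires.\<close>

lemma taylor_proj_le:
  assumes "F \<in> entire" and r: "r \<in> pos_vecs"
  shows "cmod (taylor (proj F) \<beta>) * mfact \<beta> / mpow r \<beta>
    \<le> ((\<integral>w. g w \<partial>lborel) + 1) * (cmod (taylor F \<beta>) / mpow (\<chi> j. r $ j / (R $ j * R $ j)) \<beta>)"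
proof -
  have "moment \<beta> \<le> ((\<integral>w. g w \<partial>lborel) + 1) * (mpow R \<beta>)\<^sup>2"
    using moment_le[of \<beta>] by (simp add: distrib_right mult.commute add_increasing2)
  then have "cmod (taylor F \<beta>) / mpow r \<beta> * moment \<beta>
      \<le> cmod (taylor F \<beta>) / mpow r \<beta> * (((\<integral>w. g w \<partial>lborel) + 1) * (mpow R \<beta>)\<^sup>2)"
    using mpow_pos[OF r, of \<beta>] by (intro mult_left_mono) auto
  moreover have "mpow (\<chi> j. r $ j / (R $ j * R $ j)) \<beta> = mpow r \<beta> / (mpow R \<beta>)\<^sup>2"
    using mpow_divide[of r "\<chi> j. R $ j * R $ j" \<beta>] mpow_mult[of R R \<beta>] by (simp add: power2_eq_square)
  ultimately show ?thesis
    using moment_nonneg by (simp add: taylor_proj assms(1) norm_mult norm_divide mult_ac)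
qed

lemma proj_A0_flat1:
  assumes F: "F \<in> entire"
  shows "proj F \<in> A0_flat1"
  unfolding A0_flat1_iff
proof (intro conjI ballI)
  fix r :: "real ^ 'd" assume r: "r \<in> pos_vecs"
  let ?s = "\<chi> j. r $ j / (R $ j * R $ j)"
  have s: "?s \<in> pos_vecs" using r R_pos by (simp add: pos_vecs_def)
  obtain C where C: "C > 0" "\<And>\<beta>. cmod (taylor F \<beta>) \<le> C * mpow ?s \<beta>"
    using taylor_bounded[OF F s] by blast
  let ?K = "(\<integral>w. g w \<partial>lborel) + 1"
  have "cmod (taylor (proj F) \<beta>) \<le> ?K * C * (mpow r \<beta> / mfact \<beta>)" for \<beta>
  proof -
    have "cmod (taylor (proj F) \<beta>) * mfact \<beta> / mpow r \<beta> \<le> ?K * (cmod (taylor F \<beta>) / mpow ?s \<beta>)"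
      by (rule taylor_proj_le[OF F r])
    also have "\<dots> \<le> ?K * C"
      using C(2)[of \<beta>] mpow_pos[OF s, of \<beta>] weight_integral_nonneg
      by (intro mult_left_mono) (simp_all add: pos_divide_le_eq)
    finally show ?thesis using mpow_pos[OF r, of \<beta>] by (simp add: field_simps)
  qed
  moreover have "0 < ?K * C" using C(1) weight_integral_nonneg by (intro mult_pos_pos) auto
  ultimately show "\<exists>C>0. \<forall>\<beta>. cmod (taylor (proj F) \<beta>) \<le> C * (mpow r \<beta> / mfact \<beta>)" by blast
qed (rule proj_entire[OF F])

lemma A0_flat1_norm_proj_le:
  assumes F: "F \<in> entire" and r: "r \<in> pos_vecs"
  shows "A0_flat1_norm r (proj F)
    \<le> ((\<integral>w. g w \<partial>lborel) + 1) * entire_norm (\<chi> j. r $ j / (R $ j * R $ j)) F"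
  unfolding A0_flat1_norm_eq entire_norm_eq
proof (rule cSUP_least)
  fix \<beta>
  let ?s = "\<chi> j. r $ j / (R $ j * R $ j)"
  have s: "?s \<in> pos_vecs" using r R_pos by (simp add: pos_vecs_def)
  \<comment> \<open>A real supremum dominates its terms only over a set bounded above; Cauchy's
    estimate provides that bound.\<close>
  obtain C where "\<And>\<beta>. cmod (taylor F \<beta>) \<le> C * mpow ?s \<beta>"
    using taylor_bounded[OF F s] by blast
  then have "bdd_above (range (\<lambda>\<beta>. cmod (taylor F \<beta>) / mpow ?s \<beta>))"
    using mpow_pos[OF s] by (intro bdd_aboveI[of _ C]) (auto simp: pos_divide_le_eq)
  then have "cmod (taylor F \<beta>) / mpow ?s \<beta> \<le> (SUP \<beta>. cmod (taylor F \<beta>) / mpow ?s \<beta>)"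
    by (rule cSUP_upper[OF UNIV_I])
  then show "cmod (taylor (proj F) \<beta>) * mfact \<beta> / mpow r \<beta>
      \<le> ((\<integral>w. g w \<partial>lborel) + 1) * (SUP \<beta>. cmod (taylor F \<beta>) / mpow ?s \<beta>)"
    using weight_integral_nonneg
    by (intro order_trans[OF taylor_proj_le[OF F r]] mult_left_mono) auto
qed simp

section \<open>Inverting the operator under a geometric lower bound on the moments\<close>

context
  fixes s :: "real ^ 'd" and K :: real
  assumes s: "s \<in> pos_vecs" and K: "K > 0" and lower: "\<And>\<beta>. K * (mpow s \<beta>)\<^sup>2 \<le> moment \<beta>"
begin

lemma moment_pos: "0 < moment \<beta>"
  using lower[of \<beta>] mpow_pos[OF s, of \<beta>] K by (smt (verit) mult_pos_pos zero_less_power)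

lemma inj_on_proj: "inj_on proj entire"
proof (rule inj_onI)
  fix F G assume FG: "F \<in> entire" "G \<in> entire" and eq: "proj F = proj G"
  have "taylor F \<beta> = taylor G \<beta>" for \<beta>
    using arg_cong[OF eq, of "\<lambda>H. taylor H \<beta>"] moment_pos[of \<beta>] by (simp add: taylor_proj FG)
  then show "F = G" using FG by (intro entire_eqI) auto
qed

lemma mpow_times_square:
  "mpow (\<chi> j. r $ j * (s $ j * s $ j)) \<beta> = mpow r \<beta> * (mpow s \<beta>)\<^sup>2"
  using mpow_mult[of r "\<chi> j. s $ j * s $ j" \<beta>] mpow_mult[of s s \<beta>] by (simp add: power2_eq_square)

text \<open>The preimage is found by dividing the coefficients of G by the diagonal factors. The
  quotients stay below every geometric sequence, so they belong to an entire function.\<close>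

lemma proj_surj:
  assumes G: "G \<in> A0_flat1"
  shows "\<exists>F\<in>entire. proj F = G"
proof -
  define b where "b \<beta> = taylor G \<beta> * of_real (mfact \<beta> / moment \<beta>)" for \<beta>
  have "\<exists>F\<in>entire. taylor F = b"
  proof (rule entire_with_taylor)
    fix r :: "real ^ 'd" assume r: "r \<in> pos_vecs"
    \<comment> \<open>Applying the bound on G at radii r s^2 supplies exactly the s^(2\<beta>) that
      the lower moment bound puts in the denominator.\<close>
    let ?q = "\<chi> j. r $ j * (s $ j * s $ j)"
    have "?q \<in> pos_vecs" using r s by (simp add: pos_vecs_def)
    then obtain C where C: "C > 0" "\<And>\<beta>. cmod (taylor G \<beta>) \<le> C * (mpow ?q \<beta> / mfact \<beta>)"
      using G unfolding A0_flat1_iff by blast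
    have "cmod (b \<beta>) \<le> C / K * mpow r \<beta>" for \<beta>
    proof -
      have "cmod (b \<beta>) = cmod (taylor G \<beta>) * (mfact \<beta> / moment \<beta>)"
        using moment_pos[of \<beta>] by (simp add: b_def norm_mult norm_divide)
      also have "\<dots> \<le> C * (mpow ?q \<beta> / mfact \<beta>) * (mfact \<beta> / moment \<beta>)"
        using moment_pos[of \<beta>] by (intro mult_right_mono C) simp
      also have "\<dots> = C * mpow r \<beta> * (mpow s \<beta>)\<^sup>2 / moment \<beta>"
        by (simp add: mpow_times_square)
      also have "\<dots> \<le> C * mpow r \<beta> * (mpow s \<beta>)\<^sup>2 / (K * (mpow s \<beta>)\<^sup>2)"
        using lower[of \<beta>] C(1) K mpow_pos[OF s, of \<beta>] mpow_pos[OF r, of \<beta>] moment_pos[of \<beta>]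
        by (intro divide_left_mono mult_pos_pos mult_nonneg_nonneg) auto
      also have "\<dots> = C / K * mpow r \<beta>" using mpow_pos[OF s, of \<beta>] K by simp
      finally show ?thesis .
    qed
    then show "\<exists>C. \<forall>\<beta>. cmod (b \<beta>) \<le> C * mpow r \<beta>" by blast
  qed
  then obtain F where F: "F \<in> entire" "taylor F = b" by blast
  have "taylor (proj F) \<beta> = taylor G \<beta>" for \<beta>
    using moment_pos[of \<beta>] by (simp add: taylor_proj F b_def)
  then have "proj F = G"
    using G by (intro entire_eqI proj_entire F) (auto simp: A0_flat1_iff)
  then show ?thesis using F(1) by blast
qed

text \<open>Stated through \<open>proj F\<close>, this is the explicit continuity estimate for the
  inverse, so the open mapping theorem is not invoked.\<close>

lemma entire_norm_le_proj:
  assumes F: "F \<in> entire" and r: "r \<in> pos_vecs"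
  shows "entire_norm r F \<le> 1 / K * A0_flat1_norm (\<chi> j. r $ j * (s $ j * s $ j)) (proj F)"
  unfolding A0_flat1_norm_eq entire_norm_eq
proof (rule cSUP_least)
  fix \<beta>
  let ?q = "\<chi> j. r $ j * (s $ j * s $ j)"
  have q: "?q \<in> pos_vecs" using r s by (simp add: pos_vecs_def)
  let ?f = "\<lambda>\<beta>. cmod (taylor (proj F) \<beta>) * mfact \<beta> / mpow ?q \<beta>"
  obtain C where C: "\<And>\<beta>. cmod (taylor (proj F) \<beta>) \<le> C * (mpow ?q \<beta> / mfact \<beta>)"
    using proj_A0_flat1[OF F] q unfolding A0_flat1_iff by blast
  have "?f \<beta> \<le> C" for \<beta>
    using C[of \<beta>] mpow_pos[OF q, of \<beta>] by (simp add: field_simps)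
  then have "bdd_above (range ?f)" by (intro bdd_aboveI[of _ C]) auto
  then have upper: "?f \<beta> \<le> (SUP \<beta>. ?f \<beta>)" by (rule cSUP_upper[OF UNIV_I])
  have "K * (mpow s \<beta>)\<^sup>2 * (cmod (taylor F \<beta>) / mpow ?q \<beta>) \<le> moment \<beta> * (cmod (taylor F \<beta>) / mpow ?q \<beta>)"
    using mpow_pos[OF q, of \<beta>] by (intro mult_right_mono lower) simp
  also have "\<dots> = ?f \<beta>"
    using moment_pos[of \<beta>] by (simp add: taylor_proj F norm_mult norm_divide mult_ac)
  finally have "K * (cmod (taylor F \<beta>) / mpow r \<beta>) \<le> ?f \<beta>"
    using mpow_pos[OF s, of \<beta>] by (simp add: mpow_times_square)
  then show "cmod (taylor F \<beta>) / mpow r \<beta> \<le> 1 / K * (SUP \<beta>. ?f \<beta>)"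
    using upper K by (simp add: field_simps)
qed simp

end

end

section \<open>Homeomorphisms between seminorm topologies\<close>

lemma continuous_map_seminorm_topology:
  assumes T: "\<And>F. F \<in> S \<Longrightarrow> T F \<in> S'"
    and bound: "\<And>i. i \<in> I' \<Longrightarrow> \<exists>j\<in>I. \<exists>C>0. \<forall>F\<in>S. \<forall>G\<in>S.
      p' i (\<lambda>z. T G z - T F z) \<le> C * p j (\<lambda>z. G z - F z)"
  shows "continuous_map (seminorm_topology S I p) (seminorm_topology S' I' p') T"
  unfolding continuous_map_def topspace_seminorm_topology
proof (intro conjI allI impI)
  show "T \<in> S \<rightarrow> S'" using T by blast
  fix U assume "openin (seminorm_topology S' I' p') U"
  then have U: "\<And>F. F \<in> U \<Longrightarrow> \<exists>J \<epsilon>. finite J \<and> J \<subseteq> I' \<and> \<epsilon> > 0 \<and>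
        {G \<in> S'. \<forall>i\<in>J. p' i (\<lambda>z. G z - F z) < \<epsilon>} \<subseteq> U"
    unfolding openin_seminorm_topology by blast
  obtain j C where jC: "\<And>i. i \<in> I' \<Longrightarrow> j i \<in> I" "\<And>i. i \<in> I' \<Longrightarrow> C i > 0"
    "\<And>i F G. i \<in> I' \<Longrightarrow> F \<in> S \<Longrightarrow> G \<in> S \<Longrightarrow> p' i (\<lambda>z. T G z - T F z) \<le> C i * p (j i) (\<lambda>z. G z - F z)"
    using bound by metis
  show "openin (seminorm_topology S I p) {F \<in> S. T F \<in> U}"
    unfolding openin_seminorm_topology
  proof (intro conjI ballI)
    fix F assume F: "F \<in> {F \<in> S. T F \<in> U}"
    then obtain J \<epsilon> where J: "finite J" "J \<subseteq> I'" "\<epsilon> > 0"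
      "{G \<in> S'. \<forall>i\<in>J. p' i (\<lambda>z. G z - T F z) < \<epsilon>} \<subseteq> U"
      using U[of "T F"] by blast
    \<comment> \<open>A single radius that works for the finitely many indices in J; the summand 1
      keeps the denominator positive when J is empty.\<close>
    define \<delta> where "\<delta> = \<epsilon> / (1 + (\<Sum>i\<in>J. C i))"
    have Csum: "C i < 1 + (\<Sum>i\<in>J. C i)" "0 < 1 + (\<Sum>i\<in>J. C i)" if "i \<in> J" for i
      using member_le_sum[of i J C] that J(1,2) jC(2) by (force simp: less_imp_le)+
    have "0 \<le> (\<Sum>i\<in>J. C i)" using J(2) jC(2) by (intro sum_nonneg) (auto intro: less_imp_le)
    then have \<delta>: "\<delta> > 0" using J(3) by (simp add: \<delta>_def)
    have "{G \<in> S. \<forall>i\<in>j ` J. p i (\<lambda>z. G z - F z) < \<delta>} \<subseteq> {F \<in> S. T F \<in> U}"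
    proof safe
      fix G assume G: "G \<in> S" "\<forall>i\<in>j ` J. p i (\<lambda>z. G z - F z) < \<delta>"
      have "p' i (\<lambda>z. T G z - T F z) < \<epsilon>" if i: "i \<in> J" for i
      proof -
        have "p' i (\<lambda>z. T G z - T F z) \<le> C i * p (j i) (\<lambda>z. G z - F z)"
          using jC(3)[of i F G] i J(2) F G(1) by blast
        also have "\<dots> < C i * \<delta>" using G(2) i J(2) jC(2)[of i] by (intro mult_strict_left_mono) auto
        also have "\<dots> \<le> (1 + (\<Sum>i\<in>J. C i)) * \<delta>" using Csum(1)[OF i] \<delta> by (intro mult_right_mono) auto
        also have "\<dots> = \<epsilon>" using Csum(2)[OF i] by (simp add: \<delta>_def)
        finally show ?thesis .
      qed
      then show "T G \<in> U" using J(4) T[OF G(1)] by blast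
    qed
    moreover have "finite (j ` J)" "j ` J \<subseteq> I" using J jC(1) by auto
    ultimately show "\<exists>J \<epsilon>. finite J \<and> J \<subseteq> I \<and> \<epsilon> > 0 \<and>
        {G \<in> S. \<forall>i\<in>J. p i (\<lambda>z. G z - F z) < \<epsilon>} \<subseteq> {F \<in> S. T F \<in> U}"
      using \<delta> by blast
  qed simp
qed

text \<open>The backward estimate is phrased through \<open>T\<close>, so that no formula for the
  inverse is needed; substituting preimages turns it into a bound for the inverse map.\<close>

lemma homeomorphic_map_seminorm_topology:
  assumes bij: "bij_betw T S S'"
    and fwd: "\<And>i. i \<in> I' \<Longrightarrow> \<exists>j\<in>I. \<exists>C>0. \<forall>F\<in>S. \<forall>G\<in>S.
      p' i (\<lambda>z. T G z - T F z) \<le> C * p j (\<lambda>z. G z - F z)"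
    and bwd: "\<And>j. j \<in> I \<Longrightarrow> \<exists>i\<in>I'. \<exists>C>0. \<forall>F\<in>S. \<forall>G\<in>S.
      p j (\<lambda>z. G z - F z) \<le> C * p' i (\<lambda>z. T G z - T F z)"
  shows "homeomorphic_map (seminorm_topology S I p) (seminorm_topology S' I' p') T"
proof -
  let ?V = "inv_into S T"
  have V: "?V F \<in> S" "T (?V F) = F" if "F \<in> S'" for F
    using bij that by (auto simp: bij_betw_def inv_into_into f_inv_into_f)
  have "continuous_map (seminorm_topology S' I' p') (seminorm_topology S I p) ?V"
  proof (rule continuous_map_seminorm_topology)
    fix j assume "j \<in> I"
    then obtain i C where "i \<in> I'" "C > 0" and iC: "\<And>F G. F \<in> S \<Longrightarrow> G \<in> S \<Longrightarrow>
        p j (\<lambda>z. G z - F z) \<le> C * p' i (\<lambda>z. T G z - T F z)"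
      using bwd by blast
    moreover have "p j (\<lambda>z. ?V G z - ?V F z) \<le> C * p' i (\<lambda>z. G z - F z)" if "F \<in> S'" "G \<in> S'" for F G
      using iC[of "?V F" "?V G"] V that by simp
    ultimately show "\<exists>i\<in>I'. \<exists>C>0. \<forall>F\<in>S'. \<forall>G\<in>S'. p j (\<lambda>z. ?V G z - ?V F z) \<le> C * p' i (\<lambda>z. G z - F z)"
      by blast
  qed (rule V)
  moreover have "continuous_map (seminorm_topology S I p) (seminorm_topology S' I' p') T"
    by (rule continuous_map_seminorm_topology[OF _ fwd]) (use bij in \<open>auto simp: bij_betw_def\<close>)
  ultimately have "homeomorphic_maps (seminorm_topology S I p) (seminorm_topology S' I' p') T ?V"
    using bij V by (auto simp: homeomorphic_maps_def bij_betw_def inv_into_f_f)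
  then show ?thesis by (auto simp: homeomorphic_map_maps)
qed

section \<open>The weight attached to an element of \<open>R_infty\<close>\<close>

lemma R_infty_weight:
  fixes h :: "complex ^ 'd::finite \<Rightarrow> real"
  assumes "h \<in> R_infty"
  obtains g R t c where "reinhardt_weight g R" "t \<in> pos_vecs" "0 < c"
    "AE w in lborel. w \<in> polydisc t \<longrightarrow> c \<le> g w"
    "\<And>F. F \<in> entire \<Longrightarrow> Pi_A (\<lambda>w. F w * complex_of_real (h w)) = reinhardt_weight.proj g F"
proof -
  obtain t1 t2 where t: "t1 \<in> pos_vecs" "t2 \<in> pos_vecs" "h \<in> R_infty_on t1 t2"
    using assms unfolding R_infty_def by blast
  then obtain B h0 c where h: "h \<in> borel_measurable lebesgue"
    "AE w in lborel. \<bar>h w\<bar> \<le> B" "AE w in lborel. 0 \<le> h w"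
    "AE w in lborel. w \<notin> closure (polydisc t2) \<longrightarrow> h w = 0"
    "AE w in lborel. h w = h0 (\<chi> j. cmod (w $ j))"
    "0 < c" "AE w in lborel. w \<in> polydisc t1 \<longrightarrow> c \<le> h w"
    unfolding R_infty_on_def AE_completion_iff by blast
  \<comment> \<open>The Lebesgue measurable h is replaced by a Borel function equal to it almost
    everywhere, so that the weight lives on \<open>lborel\<close>, where rotations act
    measurably.\<close>
  obtain h' where h' [measurable]: "h' \<in> borel_measurable lborel" and eq: "AE w in lborel. h w = h' w"
    using completion_ex_borel_measurable_real[OF h(1)] by blast
  define D where "D = {w :: complex ^ 'd. \<forall>j. cmod (w $ j) \<le> t2 $ j}"
  have "compact D" unfolding D_def by (rule compact_closed_polydisc)
  then have D [measurable]: "D \<in> sets borel" and fin: "emeasure lborel D < \<infinity>"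
    using emeasure_bounded_finite[OF compact_imp_bounded] by (auto intro: borel_compact)
  have "closure (polydisc t2) \<subseteq> D"
    using \<open>compact D\<close> by (intro closure_minimal compact_imp_closed) (auto simp: polydisc_def D_def less_imp_le)
  then have supp: "AE w in lborel. w \<notin> D \<longrightarrow> h w = 0"
    using h(4) by (auto elim!: eventually_mono)
  define g where "g w = exp (- (norm w)\<^sup>2) / pi ^ CARD('d) * h' w" for w :: "complex ^ 'd"
  have [measurable]: "g \<in> borel_measurable borel"
    unfolding g_def using h' by measurable
  have g_h: "AE w in lborel. g w = exp (- (norm w)\<^sup>2) / pi ^ CARD('d) * h w"
    using eq by eventually_elim (simp add: g_def)
  have rw: "reinhardt_weight g t2"
  proof
    show "AE w in lborel. 0 \<le> g w"
      using g_h h(3) by eventually_elim simp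
    show "AE w in lborel. g w = 0 \<or> (\<forall>j. cmod (w $ j) \<le> t2 $ j)"
      using g_h supp by eventually_elim (auto simp: D_def)
    show "\<exists>g0. AE w in lborel. g w = g0 (\<chi> j. cmod (w $ j))"
    proof (rule exI)
      have n: "norm (\<chi> j. cmod (w $ j)) = norm w" for w :: "complex ^ 'd" by (simp add: norm_vec_def)
      show "AE w in lborel. g w = (\<lambda>x. exp (- (norm x)\<^sup>2) / pi ^ CARD('d) * h0 x) (\<chi> j. cmod (w $ j))"
        using g_h h(5) by eventually_elim (simp add: n)
    qed
    show "integrable lborel g"
    proof (rule Bochner_Integration.integrable_bound)
      show "integrable lborel (\<lambda>w. \<bar>B\<bar> / pi ^ CARD('d) * indicator D w)"
        using fin by (intro integrable_mult_right) (simp add: integrable_indicator_iff)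
      show "AE w in lborel. norm (g w) \<le> norm (\<bar>B\<bar> / pi ^ CARD('d) * indicator D w)"
        using g_h supp h(2)
      proof eventually_elim
        case (elim w)
        have "exp (- (norm w)\<^sup>2) * \<bar>h w\<bar> \<le> 1 * \<bar>B\<bar>"
          using elim(3) by (intro mult_mono) auto
        then show ?case using elim(1,2)
          by (cases "w \<in> D") (auto simp: abs_mult divide_right_mono)
      qed
    qed simp
  qed (rule t(2))
  have "bounded (polydisc t1 :: (complex ^ 'd) set)"
    by (rule bounded_subset[OF compact_imp_bounded[OF compact_closed_polydisc[of t1]]])
      (auto simp: polydisc_def less_imp_le)
  then obtain b where b: "\<And>w :: complex ^ 'd. w \<in> polydisc t1 \<Longrightarrow> norm w \<le> b"
    unfolding bounded_iff by blast
  \<comment> \<open>On the bounded polydisc the Gaussian is at least exp(-b^2), which turns the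
    lower bound for h into one for g.\<close>
  have lower: "AE w in lborel. w \<in> polydisc t1 \<longrightarrow> exp (- b\<^sup>2) / pi ^ CARD('d) * c \<le> g w"
    using g_h h(7)
  proof eventually_elim
    case (elim w)
    show ?case
    proof
      assume w: "w \<in> polydisc t1"
      then have "(norm w)\<^sup>2 \<le> b\<^sup>2" by (intro power_mono b) simp_all
      then have "exp (- b\<^sup>2) / pi ^ CARD('d) * c \<le> exp (- (norm w)\<^sup>2) / pi ^ CARD('d) * h w"
        using elim(2) w h(6) by (intro mult_mono divide_right_mono) auto
      then show "exp (- b\<^sup>2) / pi ^ CARD('d) * c \<le> g w" using elim(1) by simp
    qed
  qed
  have proj: "Pi_A (\<lambda>w. F w * complex_of_real (h w)) = reinhardt_weight.proj g F" if F: "F \<in> entire" for F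
  proof
    fix z :: "complex ^ 'd"
    have [measurable]: "F \<in> borel_measurable borel"
      by (intro borel_measurable_continuous_onI entire_continuous_on F)
    have [measurable]: "(\<lambda>w. herm z w) \<in> borel_measurable borel"
      unfolding herm_def by (intro borel_measurable_continuous_onI continuous_intros)
    let ?k = "\<lambda>w. exp (herm z w - of_real ((norm w)\<^sup>2))"
    have m: "(\<lambda>w. F w * complex_of_real (h' w) * ?k w) \<in> borel_measurable lborel"
      using h' by measurable
    have "(\<integral>w. F w * complex_of_real (h w) * ?k w \<partial>lebesgue) = (\<integral>w. F w * complex_of_real (h' w) * ?k w \<partial>lebesgue)"
    proof (rule integral_cong_AE)
      have l: "f \<in> borel_measurable lebesgue" if "f \<in> borel_measurable borel" for f :: "complex ^ 'd \<Rightarrow> complex"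
        using that by (intro measurable_completion) simp
      have "(\<lambda>w. F w * ?k w) \<in> borel_measurable lebesgue" by (rule l) measurable
      moreover have "(\<lambda>w. complex_of_real (h w)) \<in> borel_measurable lebesgue" using h(1) by measurable
      ultimately have "(\<lambda>w. F w * ?k w * complex_of_real (h w)) \<in> borel_measurable lebesgue" by simp
      then show "(\<lambda>w. F w * complex_of_real (h w) * ?k w) \<in> borel_measurable lebesgue" by (simp add: mult_ac)
      show "(\<lambda>w. F w * complex_of_real (h' w) * ?k w) \<in> borel_measurable lebesgue"
        using m by (intro l) simp
      show "AE w in lebesgue. F w * complex_of_real (h w) * ?k w = F w * complex_of_real (h' w) * ?k w"
        unfolding AE_completion_iff using eq by eventually_elim simp
    qed
    also have "\<dots> = (\<integral>w. F w * complex_of_real (h' w) * ?k w \<partial>lborel)"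
      by (rule integral_completion[OF m])
    finally have "Pi_A (\<lambda>w. F w * complex_of_real (h w)) z
        = of_real (1 / pi ^ CARD('d)) * (\<integral>w. F w * complex_of_real (h' w) * ?k w \<partial>lborel)"
      by (simp add: Pi_A_def)
    also have "\<dots> = (\<integral>w. of_real (1 / pi ^ CARD('d)) * (F w * complex_of_real (h' w) * ?k w) \<partial>lborel)"
      by (rule integral_mult_right_zero[symmetric])
    also have "\<dots> = (\<integral>w. g w *\<^sub>R (F w * exp (herm z w)) \<partial>lborel)"
    proof (rule Bochner_Integration.integral_cong[OF refl])
      fix w
      have "?k w = exp (herm z w) * of_real (exp (- (norm w)\<^sup>2))"
        by (simp add: exp_diff exp_minus exp_of_real divide_inverse flip: of_real_power)
      then show "of_real (1 / pi ^ CARD('d)) * (F w * complex_of_real (h' w) * ?k w) = g w *\<^sub>R (F w * exp (herm z w))"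
        by (simp add: g_def scaleR_conv_of_real)
    qed
    finally show "Pi_A (\<lambda>w. F w * complex_of_real (h w)) z = reinhardt_weight.proj g F z"
      by (simp add: reinhardt_weight.proj_def[OF rw])
  qed
  show thesis
    by (rule that[OF rw t(1) _ lower proj]) (use h(6) in simp_all)
qed

theorem theorem3p4:
  fixes h :: "complex ^ 'd::finite \<Rightarrow> real"
  assumes "h \<in> R_infty"
  shows "(\<forall>F\<in>entire.
            (F \<in> A0_flat1 \<longleftrightarrow>
              (\<forall>r\<in>pos_vecs. \<exists>C>0. \<forall>z. cmod (F z) \<le> C * exp (\<Sum>j\<in>UNIV. r $ j * cmod (z $ j)))) \<and>
            (F \<in> A0_flat1 \<longleftrightarrow>
              (\<exists>F0\<in>entire. F = Pi_A (\<lambda>w. F0 w * complex_of_real (h w))))) \<and>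
         homeomorphic_map entire_topology A0_flat1_topology
           (\<lambda>F. Pi_A (\<lambda>w. F w * complex_of_real (h w)))"
proof -
  obtain g R t c where w: "reinhardt_weight g R" and t: "t \<in> pos_vecs" and c: "0 < c"
    "AE w in lborel. w \<in> polydisc t \<longrightarrow> c \<le> g w"
    and Pi: "\<And>F. F \<in> entire \<Longrightarrow> Pi_A (\<lambda>w. F w * complex_of_real (h w)) = reinhardt_weight.proj g F"
    by (rule R_infty_weight[OF assms]) (rule that)
  interpret reinhardt_weight g R by (rule w)
  \<comment> \<open>The halving comes from the inner radius of the shell behind the lower moment
    bound.\<close>
  define s where "s = (1/2) *\<^sub>R t"
  have s: "s \<in> pos_vecs" using t by (simp add: s_def pos_vecs_def)
  obtain K where K: "K > 0" "\<And>\<beta>. K * (mpow s \<beta>)\<^sup>2 \<le> moment \<beta>"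
    using moment_ge[OF t c] unfolding s_def by blast
  note bounds = s K
  let ?T = "\<lambda>F. Pi_A (\<lambda>w. F w * complex_of_real (h w))"
  have image: "F \<in> A0_flat1 \<longleftrightarrow> (\<exists>F0\<in>entire. F = ?T F0)" for F
    using proj_A0_flat1 proj_surj[OF bounds] Pi by metis
  have "inj_on ?T entire"
    using inj_on_proj[OF bounds] by (simp add: Pi cong: inj_on_cong)
  then have bij: "bij_betw ?T entire A0_flat1"
    using image by (auto simp: bij_betw_def)
  have diff: "(\<lambda>z. ?T G z - ?T F z) = proj (\<lambda>z. G z - F z)" if "F \<in> entire" "G \<in> entire" for F G
    using that by (simp add: Pi proj_diff)
  have "homeomorphic_map entire_topology A0_flat1_topology ?T"
    unfolding entire_topology_def A0_flat1_topology_def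
  proof (rule homeomorphic_map_seminorm_topology[OF bij])
    fix r :: "real ^ 'd" assume r: "r \<in> pos_vecs"
    let ?q = "\<chi> j. r $ j / (R $ j * R $ j)"
    have "?q \<in> pos_vecs" using r R_pos by (simp add: pos_vecs_def)
    moreover have "(\<integral>w. g w \<partial>lborel) + 1 > 0" using weight_integral_nonneg by simp
    moreover have "\<forall>F\<in>entire. \<forall>G\<in>entire. A0_flat1_norm r (\<lambda>z. ?T G z - ?T F z)
        \<le> ((\<integral>w. g w \<partial>lborel) + 1) * entire_norm ?q (\<lambda>z. G z - F z)"
      using A0_flat1_norm_proj_le[OF _ r] by (simp add: diff entire_diff)
    ultimately show "\<exists>q\<in>pos_vecs. \<exists>C>0. \<forall>F\<in>entire. \<forall>G\<in>entire.
        A0_flat1_norm r (\<lambda>z. ?T G z - ?T F z) \<le> C * entire_norm q (\<lambda>z. G z - F z)" by blast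
  next
    fix r :: "real ^ 'd" assume r: "r \<in> pos_vecs"
    let ?q = "\<chi> j. r $ j * (s $ j * s $ j)"
    have "?q \<in> pos_vecs" using r s by (simp add: pos_vecs_def)
    moreover have "1 / K > 0" using K by simp
    moreover have "\<forall>F\<in>entire. \<forall>G\<in>entire. entire_norm r (\<lambda>z. G z - F z)
        \<le> 1 / K * A0_flat1_norm ?q (\<lambda>z. ?T G z - ?T F z)"
      using entire_norm_le_proj[OF bounds _ r] by (simp add: diff entire_diff)
    ultimately show "\<exists>q\<in>pos_vecs. \<exists>C>0. \<forall>F\<in>entire. \<forall>G\<in>entire.
        entire_norm r (\<lambda>z. G z - F z) \<le> C * A0_flat1_norm q (\<lambda>z. ?T G z - ?T F z)" by blast
  qed
  then show ?thesis using A0_flat1_iff_growth image by blast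
qed

end
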